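(* Case (A). Given a smooth positive function $r(u): I\subset\mathbb{R}\to\mathbb{R}$ on an open interval $I$, such that $(r')^2>1$ and $r r''+(r')^2-1\neq 0$ on $I$, define the functions $$\varphi(u)=\eta\int\frac{r r''+(r')^2-1}{r(1-(r')^2)}\,du,\qquad \eta=\pm1,$$ and $$x_2(u)=\int\sqrt{(r')^2-1}\,\sinh\varphi(u)\,du,\qquad x_4(u)=\int\sqrt{(r')^2-1}\,\cosh\varphi(u)\,du.$$ Then the spacelike curve $c:\ \widetilde z(u)=(r(u),x_2(u),0,x_4(u))$ is a generating curve of a quasi-minimal rotational surface of hyperbolic type. Case (B). Given a smooth positive function $r(u): I\subset\mathbb{R}\to\mathbb{R}$ on an open interval $I$, such that $(r')^2<1$ and $r r''+(r')^2-1\neq 0$ on $I$, define the functions $$\varphi(u)=\eta\int\frac{r r''+(r')^2-1}{r(1-(r')^2)}\,du,\qquad \eta=\pm1,$$ and $$x_2(u)=\int\sqrt{1-(r')^2}\,\cosh\varphi(u)\,du,\qquad x_4(u)=\int\sqrt{1-(r')^2}\,\sinh\varphi(u)\,du.$$ Then the spacelike curve $c:\ \widetilde z(u)=(r(u),x_2(u),0,x_4(u))$ is a generating curve of a quasi-minimal rotational surface of hyperbolic type. Conversely, any quasi-minimal rotational surface of hyperbolic type (with $(r')^2\neq1$) is locally described by one of the cases (A), (B) given above.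
   Context: $\mathbb{E}^4_2$ is $\mathbb{R}^4$ with the indefinite inner product $\langle x,y\rangle=x_1y_1+x_2y_2-x_3y_3-x_4y_4$. A vector $v$ is spacelike if $\langle v,v\rangle>0$, timelike if $\langle v,v\rangle<0$, lightlike if $v\ne0$ and $\langle v,v\rangle=0$. A smooth curve is spacelike if its velocity is spacelike at each point. A surface is Lorentz if its induced metric has signature $(1,1)$; then its normal spaces also have signature $(1,1)$. For a Lorentz surface, the second fundamental form $\sigma(x,y)$ is the normal component of $\nabla'_x y$, where $\nabla'$ is the Levi-Civita connection of $\mathbb{E}^4_2$ and $x,y$ are tangent vector fields. The mean curvature vector field is $H=\frac12\operatorname{tr}\sigma$ (trace with respect to the induced metric). The surface is quasi-minimal if $H$ is lightlike at each point, i.e. $H\neq0$ and $\langle H,H\rangle=0$. Rotational surface of hyperbolic type: let $J\subset\mathbb{R}$ be an open interval and $\widetilde z(u)=(r(u),x_2(u),0,x_4(u))$, $u\in J$, a smooth spacelike curve with $r>0$, parameterized by arc-length, i.e. $(r')^2+(x_2')^2-(x_4')^2=1$. The rotational surface of hyperbolic type $\mathcal{M}''$ with generating curve $\widetilde z$ is the Lorentz surface $z(u,v)=(r(u)\cosh v,\,x_2(u),\,r(u)\sinh v,\,x_4(u))$, $u\in J$, $v\in\mathbb{R}$. Standing assumption: $(r')^2\neq1$. The indefinite integrals denote arbitrary antiderivatives, so $\varphi$, $x_2$, $x_4$ are determined up to integration constants. *)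

theory Defs
  imports "HOL-Analysis.Analysis"
begin

section \<open>The pseudo-Euclidean space of signature (2,2)\<close>

definition ip :: "real^4 \<Rightarrow> real^4 \<Rightarrow> real" where
  "ip x y = x$1 * y$1 + x$2 * y$2 - x$3 * y$3 - x$4 * y$4"

definition spacelike :: "real^4 \<Rightarrow> bool" where
  "spacelike v \<longleftrightarrow> ip v v > 0"

definition timelike :: "real^4 \<Rightarrow> bool" where
  "timelike v \<longleftrightarrow> ip v v < 0"

definition lightlike :: "real^4 \<Rightarrow> bool" where
  "lightlike v \<longleftrightarrow> v \<noteq> 0 \<and> ip v v = 0"

lemma vector_4 [simp]:
  "(vector [a, b, c, d] :: real^4) $ 1 = a"
  "(vector [a, b, c, d] :: real^4) $ 2 = b"
  "(vector [a, b, c, d] :: real^4) $ 3 = c"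
  "(vector [a, b, c, d] :: real^4) $ 4 = d"
  unfolding vector_def by simp_all


section \<open>Smooth maps\<close>

definition open_interval :: "real set \<Rightarrow> bool" where
  "open_interval I \<longleftrightarrow> open I \<and> is_interval I \<and> I \<noteq> {}"

primrec iter_partial ::
  "'a list \<Rightarrow> ('a::euclidean_space \<Rightarrow> 'b::real_normed_vector) \<Rightarrow> 'a \<Rightarrow> 'b" where
  "iter_partial [] f = f"
| "iter_partial (b # bs) f = (\<lambda>x. frechet_derivative (iter_partial bs f) (at x) b)"

text \<open>Smooth means \<open>C\<^sup>\<infinity>\<close>: all iterated partial derivatives exist and are (Frechet)
  differentiable, hence continuous. Meant for open \<open>D\<close>. For \<open>'a = real\<close> the only basis
  vector is \<open>1\<close>, and the iterated partial derivatives are the usual higher derivatives.\<close>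

definition smooth_on :: "'a set \<Rightarrow> ('a::euclidean_space \<Rightarrow> 'b::real_normed_vector) \<Rightarrow> bool" where
  "smooth_on D f \<longleftrightarrow>
     (\<forall>bs. set bs \<subseteq> Basis \<longrightarrow> (\<forall>x\<in>D. iter_partial bs f differentiable (at x)))"

definition spacelike_curve :: "real set \<Rightarrow> (real \<Rightarrow> real^4) \<Rightarrow> bool" where
  "spacelike_curve J c \<longleftrightarrow>
     smooth_on J c \<and> (\<forall>u\<in>J. spacelike (vector_derivative c (at u)))"


section \<open>Parametrized Lorentz surfaces and their mean curvature\<close>

text \<open>A surface is given by a parametrization \<open>z\<close> on an open set \<open>D\<close> of parameters. Vector
  fields along it are functions of the parameter \<open>p\<close> with values in \<open>real^4\<close>.\<close>

definition tangent_space :: "(real^2 \<Rightarrow> real^4) \<Rightarrow> real^2 \<Rightarrow> (real^4) set" where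
  "tangent_space z p = range (frechet_derivative z (at p))"

definition normal_space :: "(real^2 \<Rightarrow> real^4) \<Rightarrow> real^2 \<Rightarrow> (real^4) set" where
  "normal_space z p = {w. \<forall>x\<in>tangent_space z p. ip x w = 0}"

text \<open>The induced metric has signature (1,1) iff the tangent space has an orthogonal basis made
  of one spacelike and one timelike vector. Such vectors are linearly independent, so \<open>z\<close> is
  then automatically an immersion.\<close>

definition lorentz_surface :: "(real^2) set \<Rightarrow> (real^2 \<Rightarrow> real^4) \<Rightarrow> bool" where
  "lorentz_surface D z \<longleftrightarrow>
     open D \<and> smooth_on D z \<and>
     (\<forall>p\<in>D. \<exists>e f. tangent_space z p = span {e, f} \<and> spacelike e \<and> timelike f \<and> ip e f = 0)"

definition coord_field :: "(real^2 \<Rightarrow> real^4) \<Rightarrow> 2 \<Rightarrow> real^2 \<Rightarrow> real^4" where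
  "coord_field z i p = frechet_derivative z (at p) (axis i 1)"

definition induced_metric :: "(real^2 \<Rightarrow> real^4) \<Rightarrow> real^2 \<Rightarrow> real^2^2" where
  "induced_metric z p = (\<chi> i j. ip (coord_field z i p) (coord_field z j p))"

text \<open>On a Lorentz surface the tangent and normal space are complementary, so the normal
  component of a vector is well defined.\<close>

definition normal_component :: "(real^2 \<Rightarrow> real^4) \<Rightarrow> real^2 \<Rightarrow> real^4 \<Rightarrow> real^4" where
  "normal_component z p w = (THE n. n \<in> normal_space z p \<and> w - n \<in> tangent_space z p)"

text \<open>The Levi-Civita connection of the ambient space is the flat one: the derivative of the
  vector field \<open>Y\<close> along the surface in the direction \<open>X p\<close>, where \<open>X p\<close> is tangent and so
  corresponds to a unique direction in the parameter domain.\<close>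

definition ambient_connection ::
  "(real^2 \<Rightarrow> real^4) \<Rightarrow> (real^2 \<Rightarrow> real^4) \<Rightarrow> (real^2 \<Rightarrow> real^4) \<Rightarrow> real^2 \<Rightarrow> real^4" where
  "ambient_connection z X Y p =
     frechet_derivative Y (at p) (THE a. frechet_derivative z (at p) a = X p)"

definition second_fundamental_form ::
  "(real^2 \<Rightarrow> real^4) \<Rightarrow> (real^2 \<Rightarrow> real^4) \<Rightarrow> (real^2 \<Rightarrow> real^4) \<Rightarrow> real^2 \<Rightarrow> real^4" where
  "second_fundamental_form z X Y p = normal_component z p (ambient_connection z X Y p)"

text \<open>Half the metric trace of the second fundamental form, computed in the frame of coordinate
  fields with the inverse of the metric matrix.\<close>

definition mean_curvature :: "(real^2 \<Rightarrow> real^4) \<Rightarrow> real^2 \<Rightarrow> real^4" where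
  "mean_curvature z p =
     (1/2) *\<^sub>R (\<Sum>i\<in>UNIV. \<Sum>j\<in>UNIV. matrix_inv (induced_metric z p) $ i $ j *\<^sub>R
        second_fundamental_form z (coord_field z i) (coord_field z j) p)"

definition quasi_minimal :: "(real^2) set \<Rightarrow> (real^2 \<Rightarrow> real^4) \<Rightarrow> bool" where
  "quasi_minimal D z \<longleftrightarrow> lorentz_surface D z \<and> (\<forall>p\<in>D. lightlike (mean_curvature z p))"


section \<open>Rotational surfaces of hyperbolic type\<close>

definition profile_curve ::
  "(real \<Rightarrow> real) \<Rightarrow> (real \<Rightarrow> real) \<Rightarrow> (real \<Rightarrow> real) \<Rightarrow> real \<Rightarrow> real^4" where
  "profile_curve r x2 x4 u = vector [r u, x2 u, 0, x4 u]"

definition hyperbolic_rotation ::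
  "(real \<Rightarrow> real) \<Rightarrow> (real \<Rightarrow> real) \<Rightarrow> (real \<Rightarrow> real) \<Rightarrow> real^2 \<Rightarrow> real^4" where
  "hyperbolic_rotation r x2 x4 p =
     vector [r (p$1) * cosh (p$2), x2 (p$1), r (p$1) * sinh (p$2), x4 (p$1)]"

definition generating_curve ::
  "real set \<Rightarrow> (real \<Rightarrow> real) \<Rightarrow> (real \<Rightarrow> real) \<Rightarrow> (real \<Rightarrow> real) \<Rightarrow> bool" where
  "generating_curve J r x2 x4 \<longleftrightarrow>
     open_interval J \<and>
     spacelike_curve J (profile_curve r x2 x4) \<and>
     (\<forall>u\<in>J. r u > 0) \<and>
     (\<forall>u\<in>J. (deriv r u)\<^sup>2 + (deriv x2 u)\<^sup>2 - (deriv x4 u)\<^sup>2 = 1)"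

definition generates_quasi_minimal ::
  "real set \<Rightarrow> (real \<Rightarrow> real) \<Rightarrow> (real \<Rightarrow> real) \<Rightarrow> (real \<Rightarrow> real) \<Rightarrow> bool" where
  "generates_quasi_minimal J r x2 x4 \<longleftrightarrow>
     generating_curve J r x2 x4 \<and>
     quasi_minimal {p. p$1 \<in> J} (hyperbolic_rotation r x2 x4)"


section \<open>The two families\<close>

text \<open>An indefinite integral is an arbitrary antiderivative on the interval, so each defining
  formula prescribes a derivative.\<close>

definition angle_function ::
  "real set \<Rightarrow> real \<Rightarrow> (real \<Rightarrow> real) \<Rightarrow> (real \<Rightarrow> real) \<Rightarrow> bool" where
  "angle_function I \<eta> r \<phi> \<longleftrightarrow>
     (\<forall>u\<in>I. (\<phi> has_real_derivative
        \<eta> * ((r u * deriv (deriv r) u + (deriv r u)\<^sup>2 - 1) / (r u * (1 - (deriv r u)\<^sup>2)))) (at u))"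

definition case_A ::
  "real set \<Rightarrow> real \<Rightarrow> (real \<Rightarrow> real) \<Rightarrow> (real \<Rightarrow> real) \<Rightarrow> (real \<Rightarrow> real) \<Rightarrow> (real \<Rightarrow> real) \<Rightarrow> bool"
  where
  "case_A I \<eta> r \<phi> x2 x4 \<longleftrightarrow>
     open_interval I \<and> smooth_on I r \<and> (\<forall>u\<in>I. r u > 0) \<and>
     (\<forall>u\<in>I. (deriv r u)\<^sup>2 > 1) \<and>
     (\<forall>u\<in>I. r u * deriv (deriv r) u + (deriv r u)\<^sup>2 - 1 \<noteq> 0) \<and>
     \<eta> \<in> {1, -1} \<and> angle_function I \<eta> r \<phi> \<and>
     (\<forall>u\<in>I. (x2 has_real_derivative sqrt ((deriv r u)\<^sup>2 - 1) * sinh (\<phi> u)) (at u)) \<and>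
     (\<forall>u\<in>I. (x4 has_real_derivative sqrt ((deriv r u)\<^sup>2 - 1) * cosh (\<phi> u)) (at u))"

definition case_B ::
  "real set \<Rightarrow> real \<Rightarrow> (real \<Rightarrow> real) \<Rightarrow> (real \<Rightarrow> real) \<Rightarrow> (real \<Rightarrow> real) \<Rightarrow> (real \<Rightarrow> real) \<Rightarrow> bool"
  where
  "case_B I \<eta> r \<phi> x2 x4 \<longleftrightarrow>
     open_interval I \<and> smooth_on I r \<and> (\<forall>u\<in>I. r u > 0) \<and>
     (\<forall>u\<in>I. (deriv r u)\<^sup>2 < 1) \<and>
     (\<forall>u\<in>I. r u * deriv (deriv r) u + (deriv r u)\<^sup>2 - 1 \<noteq> 0) \<and>
     \<eta> \<in> {1, -1} \<and> angle_function I \<eta> r \<phi> \<and>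
     (\<forall>u\<in>I. (x2 has_real_derivative sqrt (1 - (deriv r u)\<^sup>2) * cosh (\<phi> u)) (at u)) \<and>
     (\<forall>u\<in>I. (x4 has_real_derivative sqrt (1 - (deriv r u)\<^sup>2) * sinh (\<phi> u)) (at u))"

text \<open>In the families \<open>x4\<close> (case A) resp. \<open>x2\<close> (case B) is increasing, while on a general
  generating curve it may be decreasing. An arc-length parameter is determined only up to
  translation and sign, and reversing it leaves the surface unchanged, so a piece of a surface is
  described by one of the families if this holds for one of the two orientations \<open>\<epsilon> = \<plusminus>1\<close> of the
  arc-length parameter of its generating curve.\<close>

definition described_by_cases ::
  "real set \<Rightarrow> (real \<Rightarrow> real) \<Rightarrow> (real \<Rightarrow> real) \<Rightarrow> (real \<Rightarrow> real) \<Rightarrow> bool" where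
  "described_by_cases I r x2 x4 \<longleftrightarrow>
     (\<exists>\<epsilon>\<in>{1, -1}. \<exists>\<eta> \<phi>.
        case_A ((\<lambda>u. \<epsilon> * u) ` I) \<eta>
          (\<lambda>u. r (\<epsilon> * u)) \<phi> (\<lambda>u. x2 (\<epsilon> * u)) (\<lambda>u. x4 (\<epsilon> * u)) \<or>
        case_B ((\<lambda>u. \<epsilon> * u) ` I) \<eta>
          (\<lambda>u. r (\<epsilon> * u)) \<phi> (\<lambda>u. x2 (\<epsilon> * u)) (\<lambda>u. x4 (\<epsilon> * u)))"

end

theory Submission
  imports Defs
begin

text \<open>In the orthogonal frame of coordinate fields the mean curvature vector of the rotational surface
  is \<open>(P cosh v, A, P sinh v, B) / (2 r)\<close> with \<open>P = r r'' + r'\<^sup>2 - 1\<close>, \<open>A = (r x2')'\<close> and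
  \<open>B = (r x4')'\<close>. For a unit speed profile with \<open>r'\<^sup>2 \<noteq> 1\<close> it is lightlike iff \<open>P \<noteq> 0\<close> and
  \<open>(r w)\<^sup>2 = P\<^sup>2\<close>, where \<open>w = x2' x4'' - x4' x2''\<close>. Writing \<open>(x2', x4')\<close> in hyperbolic polar
  coordinates with angle \<open>\<phi>\<close> gives \<open>w = (1 - r'\<^sup>2) \<phi>'\<close>, so this is the equation
  \<open>\<phi>' = \<plusminus> P / (r (1 - r'\<^sup>2))\<close>, with a sign that is constant on the interval by continuity.\<close>

section \<open>Smooth functions\<close>

text \<open>By unit speed the plane vector \<open>(x2', x4')\<close> has Lorentz square
  \<open>1 - r'\<^sup>2\<close>. This never vanishes, so its sign is fixed on the interval and
  decides which velocity carries \<open>cosh\<close>: \<open>x4'\<close> when it is negative (case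
  A), \<open>x2'\<close> when it is positive (case B). That velocity has no zero and hence a
  constant sign, but the sign may be negative while \<open>cosh\<close> is positive. Reversing the
  parameter \<open>u\<close> repairs this; it flips \<open>w\<close>, which enters the criterion
  only through its square.

  Hyperbolic rotations are isometries of the ambient space, so the inner products that occur depend
  on \<open>u\<close> alone and the problem becomes one about the profile curve.

  Smoothness of \<open>\<phi>\<close>, \<open>x2\<close> and \<open>x4\<close> in the families has
  to be derived from that of \<open>r\<close>. The definition of smoothness quantifies over lists of
  partial derivatives, which fits no product or chain rule directly, so the closure rules are proved
  for each finite order by induction.\<close>

primrec k_smooth ::
  "nat \<Rightarrow> 'a::euclidean_space set \<Rightarrow> ('a \<Rightarrow> 'b::real_normed_vector) \<Rightarrow> bool" where
  "k_smooth 0 D f = True"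
| "k_smooth (Suc n) D f = ((\<forall>x\<in>D. f differentiable (at x)) \<and>
     (\<forall>b\<in>Basis. k_smooth n D (\<lambda>x. frechet_derivative f (at x) b)))"

lemma iter_partial_snoc:
  "iter_partial (bs @ [b]) f = iter_partial bs (\<lambda>x. frechet_derivative f (at x) b)"
  by (induction bs) auto

text \<open>\<open>iter_partial\<close> adds each new derivative on the outside, while
  \<open>k_smooth\<close> peels off the innermost one, the last list entry. The second form hands
  the first derivative to the induction hypothesis, and that is the derivative given by the product
  and chain rules.\<close>

lemma k_smooth_iff_iter_partial:
  "k_smooth n D f \<longleftrightarrow>
     (\<forall>bs. set bs \<subseteq> Basis \<and> length bs < n \<longrightarrow> (\<forall>x\<in>D. iter_partial bs f differentiable (at x)))"
proof (induction n arbitrary: f)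
  case 0
  then show ?case by simp
next
  case (Suc n)
  show ?case
  proof
    assume L: "k_smooth (Suc n) D f"
    show "\<forall>bs. set bs \<subseteq> Basis \<and> length bs < Suc n \<longrightarrow>
        (\<forall>x\<in>D. iter_partial bs f differentiable (at x))"
    proof (intro allI impI)
      fix bs :: "'a list"
      assume bs: "set bs \<subseteq> Basis \<and> length bs < Suc n"
      show "\<forall>x\<in>D. iter_partial bs f differentiable (at x)"
      proof (cases bs rule: rev_cases)
        case Nil
        with L show ?thesis by simp
      next
        case (snoc cs c)
        with L bs have "k_smooth n D (\<lambda>x. frechet_derivative f (at x) c)" by simp
        with Suc.IH bs snoc show ?thesis by (simp add: iter_partial_snoc)
      qed
    qed
  next
    assume R: "\<forall>bs. set bs \<subseteq> Basis \<and> length bs < Suc n \<longrightarrow>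
        (\<forall>x\<in>D. iter_partial bs f differentiable (at x))"
    have "k_smooth n D (\<lambda>x. frechet_derivative f (at x) b)" if b: "b \<in> Basis" for b
      unfolding Suc.IH
    proof (intro allI impI)
      fix bs :: "'a list"
      assume "set bs \<subseteq> Basis \<and> length bs < n"
      with b R[rule_format, of "bs @ [b]"]
      show "\<forall>x\<in>D. iter_partial bs (\<lambda>x. frechet_derivative f (at x) b) differentiable (at x)"
        by (simp add: iter_partial_snoc)
    qed
    with R[rule_format, of "[]"] show "k_smooth (Suc n) D f" by simp
  qed
qed

lemma smooth_on_iff_k_smooth: "smooth_on D f \<longleftrightarrow> (\<forall>n. k_smooth n D f)"
  unfolding smooth_on_def k_smooth_iff_iter_partial by (meson lessI)

lemma k_smooth_Suc_imp: "k_smooth (Suc n) D f \<Longrightarrow> k_smooth n D f"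
  by (simp add: k_smooth_iff_iter_partial)

lemma k_smooth_has_derivative:
  "k_smooth (Suc n) D f \<Longrightarrow> x \<in> D \<Longrightarrow> (f has_derivative frechet_derivative f (at x)) (at x)"
  by (simp add: frechet_derivative_works)

text \<open>Openness makes the Frechet derivatives agree: each point of \<open>D\<close> has a
  neighbourhood on which \<open>f\<close> and \<open>g\<close> coincide.\<close>

lemma k_smooth_cong:
  assumes "open D" "\<And>x. x \<in> D \<Longrightarrow> f x = g x" "k_smooth n D f"
  shows "k_smooth n D g"
  using assms(2,3)
proof (induction n arbitrary: f g)
  case 0
  then show ?case by simp
next
  case (Suc n)
  have d: "(g has_derivative frechet_derivative f (at x)) (at x)" if "x \<in> D" for x
    using has_derivative_transform_within_open[OF k_smooth_has_derivative[OF Suc.prems(2) that]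
        assms(1) that] Suc.prems(1) by blast
  have "k_smooth n D (\<lambda>x. frechet_derivative g (at x) b)" if "b \<in> Basis" for b
  proof (rule Suc.IH)
    show "k_smooth n D (\<lambda>x. frechet_derivative f (at x) b)" using Suc.prems that by simp
  qed (simp add: frechet_derivative_at[OF d, symmetric])
  moreover have "\<forall>x\<in>D. g differentiable (at x)" using d differentiableI by blast
  ultimately show ?case by simp
qed

text \<open>This lets the derivative be any explicit formula \<open>f'\<close>. The formula matches
  \<open>frechet_derivative\<close> only at points of \<open>D\<close>, hence the appeal to
  \<open>k_smooth_cong\<close>.\<close>

lemma k_smooth_SucI:
  assumes "open D" "\<And>x. x \<in> D \<Longrightarrow> (f has_derivative f' x) (at x)"
    and "\<And>b. b \<in> Basis \<Longrightarrow> k_smooth n D (\<lambda>x. f' x b)"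
  shows "k_smooth (Suc n) D f"
proof -
  have "k_smooth n D (\<lambda>x. frechet_derivative f (at x) b)" if "b \<in> Basis" for b
    by (rule k_smooth_cong[OF assms(1) _ assms(3)[OF that]])
      (simp add: frechet_derivative_at[OF assms(2), symmetric])
  moreover have "\<forall>x\<in>D. f differentiable (at x)" using assms(2) differentiableI by blast
  ultimately show ?thesis by simp
qed

lemma k_smooth_const: "open D \<Longrightarrow> k_smooth n D (\<lambda>x. c)"
proof (induction n arbitrary: c)
  case (Suc n)
  show ?case
    by (rule k_smooth_SucI[where f' = "\<lambda>x h. 0"]) (use Suc in auto)
qed simp

lemma k_smooth_bounded_linear:
  assumes "open D" "bounded_linear f"
  shows "k_smooth n D f"
proof (cases n)
  case (Suc m)
  show ?thesis unfolding Suc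
    by (rule k_smooth_SucI[where f' = "\<lambda>x. f"])
      (use assms k_smooth_const bounded_linear_imp_has_derivative in auto)
qed simp

lemma k_smooth_add:
  assumes "open D"
  shows "k_smooth n D f \<Longrightarrow> k_smooth n D g \<Longrightarrow> k_smooth n D (\<lambda>x. f x + g x)"
proof (induction n arbitrary: f g)
  case (Suc n)
  show ?case
    by (rule k_smooth_SucI[OF assms has_derivative_add[OF k_smooth_has_derivative[OF Suc.prems(1)]
            k_smooth_has_derivative[OF Suc.prems(2)]]]) (use Suc in auto)
qed simp

text \<open>The Leibniz rule pairs \<open>f\<close> itself with a derivative of \<open>g\<close>, so
  \<open>k_smooth_Suc_imp\<close> lowers the order of \<open>f\<close> and \<open>g\<close> by one
  before the induction hypothesis applies.\<close>

lemma k_smooth_mult: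
  fixes f g :: "'a::euclidean_space \<Rightarrow> real"
  assumes "open D"
  shows "k_smooth n D f \<Longrightarrow> k_smooth n D g \<Longrightarrow> k_smooth n D (\<lambda>x. f x * g x)"
proof (induction n arbitrary: f g)
  case (Suc n)
  show ?case
    by (rule k_smooth_SucI[OF assms has_derivative_mult[OF k_smooth_has_derivative[OF Suc.prems(1)]
            k_smooth_has_derivative[OF Suc.prems(2)]]])
      (use Suc k_smooth_Suc_imp[OF Suc.prems(1)] k_smooth_Suc_imp[OF Suc.prems(2)]
        in \<open>auto intro!: k_smooth_add[OF assms]\<close>)
qed simp

lemma k_smooth_vec:
  fixes f :: "'a::euclidean_space \<Rightarrow> real^'n"
  assumes "open D"
  shows "(\<And>i. k_smooth n D (\<lambda>x. f x $ i)) \<Longrightarrow> k_smooth n D f"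
proof (induction n arbitrary: f)
  case (Suc n)
  let ?F = "\<lambda>x h. \<chi> i. frechet_derivative (\<lambda>x. f x $ i) (at x) h"
  show ?case
  proof (rule k_smooth_SucI[OF assms, where f' = ?F])
    show "(f has_derivative ?F x) (at x)" if "x \<in> D" for x
      unfolding has_derivative_componentwise_within[of f]
      using k_smooth_has_derivative[OF Suc.prems that]
      by (auto simp: Basis_vec_def inner_axis)
    show "k_smooth n D (\<lambda>x. ?F x b)" if "b \<in> Basis" for b
      by (rule Suc.IH) (use Suc.prems that in simp)
  qed
qed simp

lemma k_smooth_vec_nth:
  fixes f :: "'a::euclidean_space \<Rightarrow> real^'n"
  assumes "open D"
  shows "k_smooth n D f \<Longrightarrow> k_smooth n D (\<lambda>x. f x $ i)"
proof (induction n arbitrary: f)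
  case (Suc n)
  show ?case
    by (rule k_smooth_SucI[OF assms bounded_linear.has_derivative[OF bounded_linear_vec_nth
            k_smooth_has_derivative[OF Suc.prems]]]) (use Suc in auto)
qed simp

lemma k_smooth_real_SucI:
  fixes f :: "real \<Rightarrow> real"
  assumes "open D" "\<And>x. x \<in> D \<Longrightarrow> (f has_real_derivative f' x) (at x)" "k_smooth n D f'"
  shows "k_smooth (Suc n) D f"
  by (rule k_smooth_SucI[where f' = "\<lambda>x h. f' x * h"])
    (use assms in \<open>auto simp: has_field_derivative_def\<close>)

section \<open>Real functions: derivatives, antiderivatives and composition\<close>

lemma smooth_on_has_real_derivative:
  fixes f :: "real \<Rightarrow> real"
  assumes "smooth_on D f" "x \<in> D"
  shows "(f has_real_derivative deriv f x) (at x)"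
proof -
  have "f differentiable (at x)"
    using assms unfolding smooth_on_def by (metis empty_set empty_subsetI iter_partial.simps(1))
  then show ?thesis
    using DERIV_deriv_iff_real_differentiable by blast
qed

lemma smooth_on_deriv:
  fixes f :: "real \<Rightarrow> real"
  assumes "smooth_on D f" "open D"
  shows "smooth_on D (deriv f)"
  unfolding smooth_on_iff_k_smooth
proof
  fix n
  have "k_smooth (Suc n) D f" using assms(1) by (simp only: smooth_on_iff_k_smooth)
  then have "k_smooth n D (\<lambda>x. frechet_derivative f (at x) 1)" by simp
  then show "k_smooth n D (deriv f)"
  proof (rule k_smooth_cong[OF assms(2), rotated])
    fix x assume "x \<in> D"
    then have "(f has_derivative (*) (deriv f x)) (at x)"
      using smooth_on_has_real_derivative[OF assms(1)] by (simp add: has_field_derivative_def)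
    from frechet_derivative_at[OF this, symmetric]
    show "frechet_derivative f (at x) 1 = deriv f x" by simp
  qed
qed

lemma smooth_on_antiderivative:
  fixes f :: "real \<Rightarrow> real"
  assumes "open D" "\<And>x. x \<in> D \<Longrightarrow> (f has_real_derivative f' x) (at x)" "smooth_on D f'"
  shows "smooth_on D f"
  unfolding smooth_on_iff_k_smooth
proof
  fix n
  have "k_smooth n D f'" using assms(3) by (simp add: smooth_on_iff_k_smooth)
  with assms(1,2) have "k_smooth (Suc n) D f" by (rule k_smooth_real_SucI)
  then show "k_smooth n D f" by (rule k_smooth_Suc_imp)
qed

text \<open>The chain rule composes the derivative of \<open>F\<close> with the same
  \<open>g\<close>, so the induction varies \<open>F\<close> and keeps \<open>g\<close>; the extra
  factor is absorbed by \<open>k_smooth_mult\<close>.\<close>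

lemma k_smooth_compose:
  fixes g :: "'a::euclidean_space \<Rightarrow> real"
  assumes "open D" "open E" "g ` D \<subseteq> E"
  shows "k_smooth n E F \<Longrightarrow> k_smooth n D g \<Longrightarrow> k_smooth n D (\<lambda>x. (F (g x) :: real))"
proof (induction n arbitrary: F)
  case (Suc n)
  let ?F' = "\<lambda>x. frechet_derivative F (at x) 1"
  have F': "(F has_real_derivative ?F' x) (at x)" if "x \<in> E" for x
  proof -
    have d: "(F has_derivative frechet_derivative F (at x)) (at x)"
      using k_smooth_has_derivative[OF Suc.prems(1) that] .
    then have "frechet_derivative F (at x) = (*) (?F' x)"
      using has_derivative_bounded_linear[OF d]
      by (metis (no_types, opaque_lifting) bounded_linear.linear ext linear_scale mult.commute mult.right_neutral
          real_scaleR_def)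
    with d show ?thesis by (simp add: has_field_derivative_def)
  qed
  show ?case
  proof (rule k_smooth_SucI[OF assms(1)])
    show "((\<lambda>x. F (g x)) has_derivative (\<lambda>h. ?F' (g x) * frechet_derivative g (at x) h)) (at x)"
      if "x \<in> D" for x
    proof -
      have "g x \<in> E" using that assms(3) by blast
      from has_derivative_compose[OF k_smooth_has_derivative[OF Suc.prems(2) that]
          F'[OF this, unfolded has_field_derivative_def]]
      show ?thesis by simp
    qed
    show "k_smooth n D (\<lambda>x. ?F' (g x) * frechet_derivative g (at x) b)" if "b \<in> Basis" for b
      by (rule k_smooth_mult[OF assms(1)])
        (use Suc that k_smooth_Suc_imp[OF Suc.prems(2)] in auto)
  qed
qed simp

section \<open>Closure rules and elementary functions for \<open>smooth_on\<close>\<close>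

lemma smooth_on_const: "open D \<Longrightarrow> smooth_on D (\<lambda>x. c)"
  by (simp add: smooth_on_iff_k_smooth k_smooth_const)

lemma smooth_on_bounded_linear: "open D \<Longrightarrow> bounded_linear f \<Longrightarrow> smooth_on D f"
  by (simp add: smooth_on_iff_k_smooth k_smooth_bounded_linear)

lemma smooth_on_add: "open D \<Longrightarrow> smooth_on D f \<Longrightarrow> smooth_on D g \<Longrightarrow> smooth_on D (\<lambda>x. f x + g x)"
  by (simp add: smooth_on_iff_k_smooth k_smooth_add)

lemma smooth_on_mult:
  fixes f g :: "'a::euclidean_space \<Rightarrow> real"
  shows "open D \<Longrightarrow> smooth_on D f \<Longrightarrow> smooth_on D g \<Longrightarrow> smooth_on D (\<lambda>x. f x * g x)"
  by (simp add: smooth_on_iff_k_smooth k_smooth_mult)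

lemma smooth_on_diff:
  fixes f g :: "'a::euclidean_space \<Rightarrow> real"
  assumes "open D" "smooth_on D f" "smooth_on D g"
  shows "smooth_on D (\<lambda>x. f x - g x)"
  using smooth_on_add[OF assms(1,2) smooth_on_mult[OF assms(1) smooth_on_const[OF assms(1), of "-1"] assms(3)]]
  by simp

lemma smooth_on_power2:
  fixes f :: "'a::euclidean_space \<Rightarrow> real"
  shows "open D \<Longrightarrow> smooth_on D f \<Longrightarrow> smooth_on D (\<lambda>x. (f x)\<^sup>2)"
  by (simp add: power2_eq_square smooth_on_mult)

lemma smooth_on_vec_iff:
  fixes f :: "'a::euclidean_space \<Rightarrow> real^'n"
  shows "open D \<Longrightarrow> smooth_on D f \<longleftrightarrow> (\<forall>i. smooth_on D (\<lambda>x. f x $ i))"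
  using k_smooth_vec[of D _ f] k_smooth_vec_nth[of D _ f] by (auto simp: smooth_on_iff_k_smooth)

lemma smooth_on_compose:
  fixes g :: "'a::euclidean_space \<Rightarrow> real" and F :: "real \<Rightarrow> real"
  assumes "smooth_on E F" "smooth_on D g" "open D" "open E" "g ` D \<subseteq> E"
  shows "smooth_on D (\<lambda>x. F (g x))"
  using assms k_smooth_compose[OF assms(3-5)] by (simp add: smooth_on_iff_k_smooth)

text \<open>Each function is the derivative of the other, so the two inductions run
  together.\<close>

lemma smooth_on_sinh: "smooth_on UNIV (sinh :: real \<Rightarrow> real)"
  and smooth_on_cosh: "smooth_on UNIV (cosh :: real \<Rightarrow> real)"
proof -
  have "k_smooth n UNIV (sinh :: real \<Rightarrow> real) \<and> k_smooth n UNIV (cosh :: real \<Rightarrow> real)" for n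
  proof (induction n)
    case (Suc n)
    then show ?case
      by (auto intro!: k_smooth_real_SucI[where f = sinh and f' = cosh]
          k_smooth_real_SucI[where f = cosh and f' = sinh] derivative_eq_intros
          simp del: k_smooth.simps)
  qed simp
  then show "smooth_on UNIV (sinh :: real \<Rightarrow> real)" "smooth_on UNIV (cosh :: real \<Rightarrow> real)"
    by (auto simp: smooth_on_iff_k_smooth)
qed

text \<open>Bootstrapping: the derivative is a polynomial in \<open>inverse\<close> itself, so order
  \<open>n\<close> yields order \<open>Suc n\<close>.\<close>

lemma smooth_on_inverse: "smooth_on (-{0}) (inverse :: real \<Rightarrow> real)"
proof -
  have "k_smooth n (-{0}) (inverse :: real \<Rightarrow> real)" for n
  proof (induction n)
    case (Suc n)
    show ?case
    proof (rule k_smooth_real_SucI)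
      show "(inverse has_real_derivative -1 * (inverse x * inverse x)) (at x)" if "x \<in> -{0}" for x
        using that by (auto intro!: derivative_eq_intros)
      show "k_smooth n (-{0}) (\<lambda>x::real. -1 * (inverse x * inverse x))"
        by (intro k_smooth_mult k_smooth_const Suc) auto
    qed auto
  qed simp
  then show ?thesis by (simp add: smooth_on_iff_k_smooth)
qed

text \<open>The derivative is a constant times \<open>inverse\<close> composed with
  \<open>sqrt\<close>, which inherits the order already known for \<open>sqrt\<close>.\<close>

lemma smooth_on_sqrt: "smooth_on {0<..} sqrt"
proof -
  have "k_smooth n {0<..} sqrt" for n
  proof (induction n)
    case (Suc n)
    show ?case
    proof (rule k_smooth_real_SucI)
      show "(sqrt has_real_derivative (1/2) * inverse (sqrt x)) (at x)" if "x \<in> {0<..}" for x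
        using that by (auto intro!: derivative_eq_intros)
      have "k_smooth n (-{0}) (inverse :: real \<Rightarrow> real)"
        using smooth_on_inverse by (simp add: smooth_on_iff_k_smooth)
      then have "k_smooth n {0<..} (\<lambda>x. inverse (sqrt x))"
        by (rule k_smooth_compose[where E = "-{0}" and g = sqrt, rotated 3]) (use Suc in auto)
      then show "k_smooth n {0<..} (\<lambda>x. (1/2) * inverse (sqrt x))"
        by (intro k_smooth_mult k_smooth_const) auto
    qed auto
  qed simp
  then show ?thesis by (simp add: smooth_on_iff_k_smooth)
qed

lemma smooth_on_divide:
  fixes f g :: "'a::euclidean_space \<Rightarrow> real"
  assumes "open D" "smooth_on D f" "smooth_on D g" "\<And>x. x \<in> D \<Longrightarrow> g x \<noteq> 0"
  shows "smooth_on D (\<lambda>x. f x / g x)"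
proof -
  have "smooth_on D (\<lambda>x. inverse (g x))"
    by (rule smooth_on_compose[OF smooth_on_inverse assms(3,1)]) (use assms(4) in auto)
  then show ?thesis
    unfolding divide_inverse by (rule smooth_on_mult[OF assms(1,2)])
qed

section \<open>The mean curvature of a rotational surface\<close>

lemma has_derivative_vector_4:
  assumes "(f1 has_derivative g1) F" "(f2 has_derivative g2) F"
    "(f3 has_derivative g3) F" "(f4 has_derivative g4) F"
  shows "((\<lambda>p. vector [f1 p, f2 p, f3 p, f4 p] :: real^4) has_derivative
    (\<lambda>h. vector [g1 h, g2 h, g3 h, g4 h])) F"
proof -
  \<comment> \<open>Expansion along the standard basis, so that the derivative rules for sums and
    scalings apply.\<close>
  have eq: "vector [a, b, c, d] =
      a *\<^sub>R axis 1 1 + b *\<^sub>R axis 2 1 + c *\<^sub>R axis 3 1 + d *\<^sub>R (axis 4 1 :: real^4)" for a b c d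
    by (simp add: vec_eq_iff forall_4 axis_def)
  show ?thesis
    unfolding eq by (intro has_derivative_add has_derivative_scaleR_left assms)
qed

text \<open>The derivative of \<open>hyperbolic_rotation f g k\<close> with respect to
  \<open>v\<close>, that is, the generator of the rotation in the first and third coordinates.
  Fields of these two kinds are closed under both coordinate derivatives, so they express all first
  and second derivatives of the surface.\<close>

definition boost_field :: "(real \<Rightarrow> real) \<Rightarrow> real^2 \<Rightarrow> real^4" where
  "boost_field f p = vector [f (p$1) * sinh (p$2), 0, f (p$1) * cosh (p$2), 0]"

lemma has_derivative_hyperbolic_rotation:
  assumes "(f has_real_derivative f' (p$1)) (at (p$1))"
    "(g has_real_derivative g' (p$1)) (at (p$1))" "(k has_real_derivative k' (p$1)) (at (p$1))"
  shows "(hyperbolic_rotation f g k has_derivative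
    (\<lambda>h. h$1 *\<^sub>R hyperbolic_rotation f' g' k' p + h$2 *\<^sub>R boost_field f p)) (at p)"
proof -
  have 1: "((\<lambda>p. p$i) has_derivative (\<lambda>h. h$i)) (at p)" for i
    by (rule bounded_linear_imp_has_derivative[OF bounded_linear_vec_nth])
  note c = has_derivative_compose[OF 1 assms(1)[unfolded has_field_derivative_def]]
    has_derivative_compose[OF 1 assms(2)[unfolded has_field_derivative_def]]
    has_derivative_compose[OF 1 assms(3)[unfolded has_field_derivative_def]]
  have "(cosh has_real_derivative sinh (p$2)) (at (p$2))" "(sinh has_real_derivative cosh (p$2)) (at (p$2))"
    by (auto intro!: derivative_eq_intros)
  note h = this[unfolded has_field_derivative_def, THEN has_derivative_compose[OF 1]]
  have "((\<lambda>p. vector [f (p$1) * cosh (p$2), g (p$1), f (p$1) * sinh (p$2), k (p$1)] :: real^4)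
     has_derivative (\<lambda>h. vector [f (p$1) * (sinh (p$2) * h$2) + f' (p$1) * h$1 * cosh (p$2),
       g' (p$1) * h$1, f (p$1) * (cosh (p$2) * h$2) + f' (p$1) * h$1 * sinh (p$2), k' (p$1) * h$1])) (at p)"
    by (intro has_derivative_vector_4 has_derivative_mult c h)
  then show ?thesis
    unfolding hyperbolic_rotation_def[abs_def] boost_field_def[abs_def]
    by (rule has_derivative_eq_rhs) (simp add: vec_eq_iff forall_4 fun_eq_iff algebra_simps)
qed

lemma has_derivative_boost_field:
  assumes "(f has_real_derivative f' (p$1)) (at (p$1))"
  shows "(boost_field f has_derivative
    (\<lambda>h. h$1 *\<^sub>R boost_field f' p + h$2 *\<^sub>R hyperbolic_rotation f (\<lambda>u. 0) (\<lambda>u. 0) p)) (at p)"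
proof -
  have 1: "((\<lambda>p. p$i) has_derivative (\<lambda>h. h$i)) (at p)" for i
    by (rule bounded_linear_imp_has_derivative[OF bounded_linear_vec_nth])
  note c = has_derivative_compose[OF 1 assms(1)[unfolded has_field_derivative_def]]
  have "(cosh has_real_derivative sinh (p$2)) (at (p$2))" "(sinh has_real_derivative cosh (p$2)) (at (p$2))"
    by (auto intro!: derivative_eq_intros)
  note h = this[unfolded has_field_derivative_def, THEN has_derivative_compose[OF 1]]
  have "((\<lambda>p. vector [f (p$1) * sinh (p$2), 0, f (p$1) * cosh (p$2), 0] :: real^4)
     has_derivative (\<lambda>h. vector [f (p$1) * (cosh (p$2) * h$2) + f' (p$1) * h$1 * sinh (p$2),
       0, f (p$1) * (sinh (p$2) * h$2) + f' (p$1) * h$1 * cosh (p$2), 0])) (at p)"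
    by (intro has_derivative_vector_4 has_derivative_mult c h has_derivative_const)
  then show ?thesis
    unfolding hyperbolic_rotation_def[abs_def] boost_field_def[abs_def]
    by (rule has_derivative_eq_rhs) (simp add: vec_eq_iff forall_4 fun_eq_iff algebra_simps)
qed

section \<open>Inner products of rotated fields and the normal component\<close>

lemma ip_add_left: "ip (x + y) w = ip x w + ip y w"
  and ip_scaleR_left: "ip (c *\<^sub>R x) w = c * ip x w"
  and ip_commute: "ip x y = ip y x"
  by (simp_all add: ip_def algebra_simps)

lemma ip_hyperbolic_rotation:
  "ip (hyperbolic_rotation f g k p) (hyperbolic_rotation f' g' k' p) =
     f (p$1) * f' (p$1) + g (p$1) * g' (p$1) - k (p$1) * k' (p$1)"
proof -
  have "ip (hyperbolic_rotation f g k p) (hyperbolic_rotation f' g' k' p) =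
      f (p$1) * f' (p$1) * ((cosh (p$2))\<^sup>2 - (sinh (p$2))\<^sup>2) + g (p$1) * g' (p$1) - k (p$1) * k' (p$1)"
    by (simp add: ip_def hyperbolic_rotation_def algebra_simps power2_eq_square)
  then show ?thesis by (simp add: cosh_square_eq)
qed

lemma ip_boost_field: "ip (boost_field f p) (boost_field g p) = - (f (p$1) * g (p$1))"
proof -
  have "ip (boost_field f p) (boost_field g p) =
      - (f (p$1) * g (p$1)) * ((cosh (p$2))\<^sup>2 - (sinh (p$2))\<^sup>2)"
    by (simp add: ip_def boost_field_def algebra_simps power2_eq_square)
  then show ?thesis by (simp add: cosh_square_eq)
qed

lemma ip_hyperbolic_rotation_boost_field: "ip (hyperbolic_rotation f g k p) (boost_field h p) = 0"
  by (simp add: ip_def hyperbolic_rotation_def boost_field_def)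

lemma lightlike_scaleR:
  assumes "c \<noteq> 0"
  shows "lightlike (c *\<^sub>R x) \<longleftrightarrow> lightlike x"
proof -
  have "ip (c *\<^sub>R x) (c *\<^sub>R x) = c\<^sup>2 * ip x x"
    by (simp add: ip_def algebra_simps power2_eq_square)
  with assms show ?thesis by (simp add: lightlike_def)
qed

lemma lightlike_hyperbolic_rotation:
  "lightlike (hyperbolic_rotation f g k p) \<longleftrightarrow>
     (f (p$1) \<noteq> 0 \<or> g (p$1) \<noteq> 0 \<or> k (p$1) \<noteq> 0) \<and> (f (p$1))\<^sup>2 + (g (p$1))\<^sup>2 - (k (p$1))\<^sup>2 = 0"
proof -
  \<comment> \<open>The first component then vanishes only if \<open>f\<close> does, after which the
    other components give \<open>g\<close> and \<open>k\<close>.\<close>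
  have "cosh (p$2) \<noteq> 0" using cosh_real_pos[of "p$2"] by simp
  then have "hyperbolic_rotation f g k p = 0 \<longleftrightarrow> f (p$1) = 0 \<and> g (p$1) = 0 \<and> k (p$1) = 0"
    by (auto simp: hyperbolic_rotation_def vec_eq_iff forall_4)
  then show ?thesis
    by (auto simp: lightlike_def ip_hyperbolic_rotation power2_eq_square)
qed

text \<open>Uniqueness behind the \<open>THE\<close>: the difference of two candidates is tangent
  and orthogonal to both \<open>e\<close> and \<open>f\<close>. Since these are orthogonal and
  non-null, pairing with each of them kills one coefficient.\<close>

lemma normal_component_eqI:
  assumes tan: "tangent_space z p = span {e, f}"
    and e: "ip e e \<noteq> 0" and f: "ip f f \<noteq> 0" and ef: "ip e f = 0"
    and n: "ip e n = 0" "ip f n = 0" and w: "w - n \<in> span {e, f}"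
  shows "normal_component z p w = n"
  unfolding normal_component_def
proof (rule the_equality)
  have span: "span {e, f} = {a *\<^sub>R e + b *\<^sub>R f | a b. True}"
    by (auto simp: span_insert algebra_simps)
  show "n \<in> normal_space z p \<and> w - n \<in> tangent_space z p"
    using n w unfolding normal_space_def tan
    by (auto simp: span ip_add_left ip_scaleR_left)
  fix m assume m: "m \<in> normal_space z p \<and> w - m \<in> tangent_space z p"
  then have "ip e m = 0" "ip f m = 0"
    unfolding normal_space_def tan by (auto simp: span_base)
  with n have *: "ip e (n - m) = 0" "ip f (n - m) = 0"
    by (simp_all add: ip_def algebra_simps)
  have "(w - m) - (w - n) \<in> span {e, f}"
    using m w unfolding tan by (blast intro: span_diff)
  then obtain a b where nm: "n - m = a *\<^sub>R e + b *\<^sub>R f" by (auto simp: span)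
  have "ip e (n - m) = a * ip e e + b * ip e f" "ip f (n - m) = a * ip e f + b * ip f f"
    by (simp_all add: nm ip_def algebra_simps)
  with * e f ef have "a = 0" "b = 0" by auto
  with nm show "m = n" by simp
qed

definition wronskian :: "(real \<Rightarrow> real) \<Rightarrow> (real \<Rightarrow> real) \<Rightarrow> real \<Rightarrow> real" where
  "wronskian f g u = f u * deriv g u - g u * deriv f u"

text \<open>This is \<open>axial_coeff r r u - 1\<close>. The \<open>- 1\<close> comes from the
  second \<open>v\<close>-derivative of the surface, whose radial part is \<open>r\<close>.\<close>

definition radial_coeff :: "(real \<Rightarrow> real) \<Rightarrow> real \<Rightarrow> real" where
  "radial_coeff r u = r u * deriv (deriv r) u + (deriv r u)\<^sup>2 - 1"

definition axial_coeff :: "(real \<Rightarrow> real) \<Rightarrow> (real \<Rightarrow> real) \<Rightarrow> real \<Rightarrow> real" where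
  "axial_coeff r x u = r u * deriv (deriv x) u + deriv r u * deriv x u"

lemma matrix_inv_eqI:
  fixes A :: "real^'n^'n"
  assumes "A ** B = mat 1" "B ** A = mat 1"
  shows "matrix_inv A = B"
proof -
  have "A ** matrix_inv A = mat 1 \<and> matrix_inv A ** A = mat 1"
    unfolding matrix_inv_def by (rule someI[of _ B]) (use assms in simp)
  then show ?thesis
    using assms(2) by (metis matrix_mul_assoc matrix_mul_lid matrix_mul_rid)
qed

section \<open>The surface over a unit speed profile: frame, second fundamental form, mean
  curvature\<close>

locale unit_profile =
  fixes J :: "real set" and r x2 x4 :: "real \<Rightarrow> real"
  assumes open_J: "open J"
    and smooth_r: "smooth_on J r" and smooth_x2: "smooth_on J x2" and smooth_x4: "smooth_on J x4"
    and r_pos: "u \<in> J \<Longrightarrow> r u > 0"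
    and unit_speed: "u \<in> J \<Longrightarrow> (deriv r u)\<^sup>2 + (deriv x2 u)\<^sup>2 - (deriv x4 u)\<^sup>2 = 1"
begin

lemmas has_deriv = smooth_on_has_real_derivative[OF smooth_r]
  smooth_on_has_real_derivative[OF smooth_x2] smooth_on_has_real_derivative[OF smooth_x4]

lemmas has_deriv2 = smooth_on_has_real_derivative[OF smooth_on_deriv[OF smooth_r open_J]]
  smooth_on_has_real_derivative[OF smooth_on_deriv[OF smooth_x2 open_J]]
  smooth_on_has_real_derivative[OF smooth_on_deriv[OF smooth_x4 open_J]]

text \<open>The squared speed is constant, so the acceleration of the profile is orthogonal to its
  velocity. This makes the second \<open>u\<close>-derivative of the surface a normal
  vector.\<close>

lemma unit_speed_deriv:
  assumes "u \<in> J"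
  shows "deriv r u * deriv (deriv r) u + deriv x2 u * deriv (deriv x2) u
    - deriv x4 u * deriv (deriv x4) u = 0"
proof -
  let ?f = "\<lambda>u. (deriv r u)\<^sup>2 + (deriv x2 u)\<^sup>2 - (deriv x4 u)\<^sup>2"
  have "(?f has_real_derivative 2 * (deriv r u * deriv (deriv r) u + deriv x2 u * deriv (deriv x2) u
    - deriv x4 u * deriv (deriv x4) u)) (at u)"
    using has_deriv2[OF assms] by (auto intro!: derivative_eq_intros simp: algebra_simps)
  moreover have "(?f has_real_derivative 0) (at u)"
    by (rule has_field_derivative_transform_within_open[OF DERIV_const open_J assms])
      (simp add: unit_speed)
  ultimately show ?thesis using DERIV_unique by fastforce
qed

abbreviation "surf \<equiv> hyperbolic_rotation r x2 x4"
abbreviation "params \<equiv> {p :: real^2. p$1 \<in> J}"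
abbreviation "field_u \<equiv> hyperbolic_rotation (deriv r) (deriv x2) (deriv x4)"
abbreviation "field_v \<equiv> boost_field r"

lemma open_params: "open params"
  using open_vimage_vec_nth[OF open_J, of 1] by (simp add: vimage_def)

context
  fixes p :: "real^2" assumes p: "p \<in> params"
begin

lemma frechet_surf:
  "frechet_derivative surf (at p) = (\<lambda>h. h$1 *\<^sub>R field_u p + h$2 *\<^sub>R field_v p)"
  using frechet_derivative_at[OF has_derivative_hyperbolic_rotation[of r "deriv r" p x2 "deriv x2" x4 "deriv x4"]]
    p has_deriv by auto

lemma coord_field_surf: "coord_field surf 1 p = field_u p" "coord_field surf 2 p = field_v p"
  unfolding coord_field_def frechet_surf by (simp_all add: axis_def)

lemma ip_fields:
  "ip (field_u p) (field_u p) = 1" "ip (field_v p) (field_v p) = - (r (p$1))\<^sup>2"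
  "ip (field_u p) (field_v p) = 0" "ip (field_v p) (field_u p) = 0"
proof -
  show "ip (field_u p) (field_v p) = 0" by (rule ip_hyperbolic_rotation_boost_field)
  then show "ip (field_v p) (field_u p) = 0" by (simp only: ip_commute[of "field_v p"])
qed (use unit_speed[of "p$1"] p in
    \<open>simp_all add: ip_hyperbolic_rotation ip_boost_field power2_eq_square\<close>)

lemma tangent_space_surf: "tangent_space surf p = span {field_u p, field_v p}"
proof -
  have "(\<exists>h::real^2. x = h$1 *\<^sub>R field_u p + h$2 *\<^sub>R field_v p) \<longleftrightarrow>
      (\<exists>a b. x = a *\<^sub>R field_u p + b *\<^sub>R field_v p)" for x
    by (metis vector_2)
  then show ?thesis
    unfolding tangent_space_def frechet_surf
    by (auto simp: span_insert image_def algebra_simps)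
qed

text \<open>The surface is an immersion: the frame is orthogonal with squares \<open>1\<close> and
  \<open>- r\<^sup>2\<close>, so pairing a vanishing combination with its members isolates the
  coefficients. This determines the direction chosen by \<open>THE\<close> in
  \<open>ambient_connection\<close>.\<close>

lemma surf_direction_unique:
  assumes "frechet_derivative surf (at p) a = frechet_derivative surf (at p) b"
  shows "a = b"
proof -
  from assms have "(a$1 - b$1) *\<^sub>R field_u p + (a$2 - b$2) *\<^sub>R field_v p = 0"
    unfolding frechet_surf by (simp add: algebra_simps)
  then have "ip ((a$1 - b$1) *\<^sub>R field_u p + (a$2 - b$2) *\<^sub>R field_v p) x = 0" for x
    by (simp add: ip_def)
  from this[of "field_u p"] this[of "field_v p"] r_pos[of "p$1"] p show ?thesis
    by (simp add: ip_add_left ip_scaleR_left ip_fields vec_eq_iff forall_2)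
qed

lemma ambient_connection_surf:
  "ambient_connection surf (coord_field surf i) Y p = frechet_derivative Y (at p) (axis i 1)"
proof -
  have "(THE a. frechet_derivative surf (at p) a = coord_field surf i p) = axis i 1"
    unfolding coord_field_def by (rule the_equality[OF refl surf_direction_unique])
  then show ?thesis by (simp add: ambient_connection_def)
qed

end

lemma frechet_coord_field:
  assumes p: "p \<in> params"
  shows
  "frechet_derivative (coord_field surf 1) (at p) =
     (\<lambda>h. h$1 *\<^sub>R hyperbolic_rotation (deriv (deriv r)) (deriv (deriv x2)) (deriv (deriv x4)) p
        + h$2 *\<^sub>R boost_field (deriv r) p)" (is ?u)
  "frechet_derivative (coord_field surf 2) (at p) =
     (\<lambda>h. h$1 *\<^sub>R boost_field (deriv r) p + h$2 *\<^sub>R hyperbolic_rotation r (\<lambda>u. 0) (\<lambda>u. 0) p)" (is ?v)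
proof -
  \<comment> \<open>The closed forms of the coordinate fields hold on \<open>params\<close>; its
    openness transfers their derivatives.\<close>
  note t = frechet_derivative_at[OF has_derivative_transform_within_open[OF _ open_params p], symmetric]
  have J: "p$1 \<in> J" using p by simp
  show ?u
    by (rule t[OF has_derivative_hyperbolic_rotation[of "deriv r" "deriv (deriv r)" p "deriv x2"
            "deriv (deriv x2)" "deriv x4" "deriv (deriv x4)", OF has_deriv2[OF J]]])
      (simp add: coord_field_surf)
  show ?v
    by (rule t[OF has_derivative_boost_field[of r "deriv r" p, OF has_deriv(1)[OF J]]])
      (simp add: coord_field_surf)
qed

text \<open>The second \<open>u\<close>-derivative is already normal. The second
  \<open>v\<close>-derivative has inner product \<open>r r'\<close> with the unit vector
  \<open>field_u p\<close>, so that multiple is subtracted. The frame is orthogonal, so the trace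
  consists of these two values.\<close>

lemma second_fundamental_form_surf:
  assumes p: "p \<in> params"
  shows "second_fundamental_form surf (coord_field surf 1) (coord_field surf 1) p =
      hyperbolic_rotation (deriv (deriv r)) (deriv (deriv x2)) (deriv (deriv x4)) p" (is "_ = ?n")
    and "second_fundamental_form surf (coord_field surf 2) (coord_field surf 2) p =
      hyperbolic_rotation r (\<lambda>u. 0) (\<lambda>u. 0) p - (r (p$1) * deriv r (p$1)) *\<^sub>R field_u p" (is "_ = ?m")
proof -
  have J: "p$1 \<in> J" using p by simp
  note normal = normal_component_eqI[OF tangent_space_surf[OF p]]
  have nz: "ip (field_u p) (field_u p) \<noteq> 0" "ip (field_v p) (field_v p) \<noteq> 0"
    using ip_fields[OF p] r_pos[OF J] by auto
  have "normal_component surf p ?n = ?n"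
  proof (rule normal[OF nz ip_fields(3)[OF p]])
    show "ip (field_u p) ?n = 0"
      using unit_speed_deriv[OF J] by (simp add: ip_hyperbolic_rotation)
    show "ip (field_v p) ?n = 0"
      unfolding ip_commute[of "field_v p"] by (rule ip_hyperbolic_rotation_boost_field)
  qed (simp add: span_zero)
  then show "second_fundamental_form surf (coord_field surf 1) (coord_field surf 1) p = ?n"
    by (simp add: second_fundamental_form_def ambient_connection_surf[OF p] frechet_coord_field[OF p]
        axis_def)
  have "normal_component surf p (hyperbolic_rotation r (\<lambda>u. 0) (\<lambda>u. 0) p) = ?m"
  proof (rule normal[OF nz ip_fields(3)[OF p]])
    have "ip (field_u p) ?m = ip (field_u p) (hyperbolic_rotation r (\<lambda>u. 0) (\<lambda>u. 0) p)
        - r (p$1) * deriv r (p$1) * ip (field_u p) (field_u p)"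
      by (simp add: ip_def algebra_simps)
    then show "ip (field_u p) ?m = 0"
      unfolding ip_fields[OF p] by (simp add: ip_hyperbolic_rotation)
    have "ip (field_v p) ?m = ip (hyperbolic_rotation r (\<lambda>u. 0) (\<lambda>u. 0) p) (field_v p)
        - r (p$1) * deriv r (p$1) * ip (field_u p) (field_v p)"
      by (simp add: ip_def algebra_simps)
    then show "ip (field_v p) ?m = 0"
      by (simp add: ip_fields[OF p] ip_hyperbolic_rotation_boost_field)
  qed (simp add: span_base span_scale)
  then show "second_fundamental_form surf (coord_field surf 2) (coord_field surf 2) p = ?m"
    by (simp add: second_fundamental_form_def ambient_connection_surf[OF p] frechet_coord_field[OF p]
        axis_def)
qed

lemma matrix_inv_induced_metric:
  assumes p: "p \<in> params"
  shows "matrix_inv (induced_metric surf p) =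
    (\<chi> i j. if i = j then (if i = 1 then 1 else - 1 / (r (p$1))\<^sup>2) else 0)" (is "_ = ?B")
proof (rule matrix_inv_eqI)
  have "r (p$1) \<noteq> 0" using r_pos[of "p$1"] p by auto
  then show "induced_metric surf p ** ?B = mat 1" "?B ** induced_metric surf p = mat 1"
    by (simp_all add: vec_eq_iff forall_2 matrix_matrix_mult_def sum_2 mat_def induced_metric_def
        coord_field_surf[OF p] ip_fields[OF p])
qed

text \<open>With \<open>z\<close> for the surface, twice the mean curvature vector is
  \<open>z_uu - (z_vv - r r' z_u) / r\<^sup>2\<close>. The term in \<open>z_u\<close> supplies the
  parts \<open>r'\<^sup>2\<close>, \<open>r' x2'\<close> and \<open>r' x4'\<close> of the
  coefficients.\<close>

lemma mean_curvature_surf: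
  assumes p: "p \<in> params"
  shows "mean_curvature surf p = (1 / (2 * r (p$1))) *\<^sub>R
    hyperbolic_rotation (radial_coeff r) (axial_coeff r x2) (axial_coeff r x4) p"
proof -
  have "r (p$1) \<noteq> 0" using r_pos[of "p$1"] p by auto
  then show ?thesis
    unfolding mean_curvature_def matrix_inv_induced_metric[OF p]
    by (simp add: sum_2 second_fundamental_form_surf[OF p] vec_eq_iff forall_4 hyperbolic_rotation_def
        radial_coeff_def axial_coeff_def field_simps power2_eq_square)
qed

section \<open>Smoothness, Lorentz signature and the lightlike condition\<close>

lemma smooth_on_fst: "smooth_on J f \<Longrightarrow> smooth_on params (\<lambda>p. f (p$1) :: real)"
  by (rule smooth_on_compose[OF _ _ open_params open_J])
    (auto intro: smooth_on_bounded_linear open_params bounded_linear_vec_nth)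

lemma smooth_on_snd: "smooth_on UNIV f \<Longrightarrow> smooth_on params (\<lambda>p. f (p$2) :: real)"
  by (rule smooth_on_compose[OF _ _ open_params open_UNIV])
    (auto intro: smooth_on_bounded_linear open_params bounded_linear_vec_nth)

lemma smooth_on_surf: "smooth_on params surf"
  unfolding smooth_on_vec_iff[OF open_params] forall_4
  using smooth_on_mult[OF open_params smooth_on_fst[OF smooth_r] smooth_on_snd[OF smooth_on_cosh]]
    smooth_on_mult[OF open_params smooth_on_fst[OF smooth_r] smooth_on_snd[OF smooth_on_sinh]]
    smooth_on_fst[OF smooth_x2] smooth_on_fst[OF smooth_x4]
  by (simp add: hyperbolic_rotation_def)

lemma lorentz_surface_surf: "lorentz_surface params surf"
  unfolding lorentz_surface_def spacelike_def timelike_def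
proof (intro conjI ballI open_params smooth_on_surf exI)
  fix p assume p: "p \<in> params"
  show "tangent_space surf p = span {field_u p, field_v p}" by (rule tangent_space_surf[OF p])
  show "ip (field_v p) (field_v p) < 0" using r_pos[of "p$1"] p ip_fields[OF p] by auto
qed (simp_all add: ip_fields)

text \<open>With \<open>a = x2'\<close>, \<open>b = x4'\<close>, \<open>P, A, B\<close> the coefficients of the mean curvature vector and \<open>w\<close> the
  Wronskian, unit speed gives \<open>a A - b B = - r' P\<close>, and \<open>a B - b A = r w\<close>. The Lagrange identity
  \<open>(a\<^sup>2 - b\<^sup>2) (A\<^sup>2 - B\<^sup>2) = (a A - b B)\<^sup>2 - (a B - b A)\<^sup>2\<close> then yields
  \<open>(1 - r'\<^sup>2) (P\<^sup>2 + A\<^sup>2 - B\<^sup>2) = P\<^sup>2 - (r w)\<^sup>2\<close>.\<close>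

lemma lightlike_mean_curvature_iff:
  assumes p: "p \<in> params" and nd: "(deriv r (p$1))\<^sup>2 \<noteq> 1"
  shows "lightlike (mean_curvature surf p) \<longleftrightarrow> radial_coeff r (p$1) \<noteq> 0 \<and>
    (r (p$1) * wronskian (deriv x2) (deriv x4) (p$1))\<^sup>2 = (radial_coeff r (p$1))\<^sup>2"
proof -
  define u where "u = p$1"
  have J: "u \<in> J" using p u_def by simp
  define \<rho> r1 r2 a b a' b' where "\<rho> = r u" "r1 = deriv r u" "r2 = deriv (deriv r) u"
    "a = deriv x2 u" "b = deriv x4 u" "a' = deriv (deriv x2) u" "b' = deriv (deriv x4) u"
  note defs = this
  define P A B w where "P = \<rho> * r2 + r1\<^sup>2 - 1" "A = \<rho> * a' + r1 * a" "B = \<rho> * b' + r1 * b"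
    "w = a * b' - b * a'"
  note defs' = this
  have \<rho>: "\<rho> \<noteq> 0" using r_pos[OF J] by (simp add: defs)
  have us: "a\<^sup>2 - b\<^sup>2 = 1 - r1\<^sup>2" using unit_speed[OF J] by (simp add: defs)
  have d: "a * a' - b * b' = - r1 * r2" using unit_speed_deriv[OF J] by (simp add: defs)
  have nd: "1 - r1\<^sup>2 \<noteq> 0" using nd by (simp add: defs u_def)
  have "a * A - b * B = \<rho> * (a * a' - b * b') + r1 * (a\<^sup>2 - b\<^sup>2)"
    by (simp add: defs' algebra_simps power2_eq_square)
  also have "\<dots> = - r1 * P" unfolding us d by (simp add: defs' algebra_simps power2_eq_square)
  finally have 1: "a * A - b * B = - r1 * P" .
  have 2: "a * B - b * A = \<rho> * w" by (simp add: defs' algebra_simps)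
  have "(a\<^sup>2 - b\<^sup>2) * (A\<^sup>2 - B\<^sup>2) = (a * A - b * B)\<^sup>2 - (a * B - b * A)\<^sup>2"
    by (simp add: algebra_simps power2_eq_square)
  then have "(1 - r1\<^sup>2) * (A\<^sup>2 - B\<^sup>2) = r1\<^sup>2 * P\<^sup>2 - (\<rho> * w)\<^sup>2"
    unfolding 1 2 us by (simp add: power_mult_distrib)
  then have key: "(1 - r1\<^sup>2) * (P\<^sup>2 + A\<^sup>2 - B\<^sup>2) = P\<^sup>2 - (\<rho> * w)\<^sup>2"
    by (simp add: algebra_simps)
  \<comment> \<open>The relations \<open>1\<close> and \<open>2\<close> are a linear system for
    \<open>A\<close> and \<open>B\<close> with determinant
    \<open>a\<^sup>2 - b\<^sup>2 = 1 - r1\<^sup>2\<close>, which is nonzero. Hence a lightlike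
    vector cannot have \<open>P = 0\<close>, and nonvanishing reduces to
    \<open>P \<noteq> 0\<close>.\<close>
  have AB: "A = 0 \<and> B = 0" if "P = 0" "\<rho> * w = 0"
  proof -
    have "(a\<^sup>2 - b\<^sup>2) * A = a * (a * A - b * B) + b * (a * B - b * A)"
      "(a\<^sup>2 - b\<^sup>2) * B = b * (a * A - b * B) + a * (a * B - b * A)"
      by (simp_all add: algebra_simps power2_eq_square)
    then show ?thesis unfolding 1 2 us that using nd by simp
  qed
  have "lightlike (mean_curvature surf p) \<longleftrightarrow> (P \<noteq> 0 \<or> A \<noteq> 0 \<or> B \<noteq> 0) \<and> P\<^sup>2 + A\<^sup>2 - B\<^sup>2 = 0"
    unfolding mean_curvature_surf[OF p] using \<rho>
    by (simp add: lightlike_scaleR lightlike_hyperbolic_rotation radial_coeff_def axial_coeff_def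
        defs defs' u_def)
  also have "\<dots> \<longleftrightarrow> (P \<noteq> 0 \<or> A \<noteq> 0 \<or> B \<noteq> 0) \<and> (\<rho> * w)\<^sup>2 = P\<^sup>2"
    using key nd by (metis eq_iff_diff_eq_0 mult_eq_0_iff)
  also have "\<dots> \<longleftrightarrow> P \<noteq> 0 \<and> (\<rho> * w)\<^sup>2 = P\<^sup>2"
    using AB by auto
  finally show ?thesis
    by (simp add: radial_coeff_def wronskian_def defs defs' u_def)
qed

lemma quasi_minimal_iff:
  assumes "\<And>u. u \<in> J \<Longrightarrow> (deriv r u)\<^sup>2 \<noteq> 1"
  shows "quasi_minimal params surf \<longleftrightarrow> (\<forall>u\<in>J. radial_coeff r u \<noteq> 0 \<and>
    (r u * wronskian (deriv x2) (deriv x4) u)\<^sup>2 = (radial_coeff r u)\<^sup>2)"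
proof -
  \<comment> \<open>Every \<open>u\<close> in \<open>J\<close> is the first coordinate of a
    parameter point, and the criterion does not involve \<open>v\<close>.\<close>
  have "(\<forall>p\<in>params. Q (p$1)) \<longleftrightarrow> (\<forall>u\<in>J. Q u)" for Q
    by (metis (mono_tags, lifting) mem_Collect_eq vector_2(1))
  from this[of "\<lambda>u. radial_coeff r u \<noteq> 0 \<and>
    (r u * wronskian (deriv x2) (deriv x4) u)\<^sup>2 = (radial_coeff r u)\<^sup>2"] show ?thesis
    unfolding quasi_minimal_def
    using lorentz_surface_surf lightlike_mean_curvature_iff assms by auto
qed

lemma has_vector_derivative_profile_curve:
  assumes "u \<in> J"
  shows "(profile_curve r x2 x4 has_vector_derivative
    vector [deriv r u, deriv x2 u, 0, deriv x4 u]) (at u)"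
proof -
  note d = has_deriv[OF assms, unfolded has_field_derivative_def]
  have "((\<lambda>u. vector [r u, x2 u, 0, x4 u] :: real^4) has_derivative
      (\<lambda>h. vector [deriv r u * h, deriv x2 u * h, 0, deriv x4 u * h])) (at u)"
    by (intro has_derivative_vector_4 d has_derivative_const)
  then show ?thesis
    unfolding has_vector_derivative_def profile_curve_def[abs_def]
    by (rule has_derivative_eq_rhs) (simp add: vec_eq_iff forall_4 fun_eq_iff)
qed

end

lemma smooth_on_profile_curve_iff:
  assumes "open J"
  shows "smooth_on J (profile_curve r x2 x4) \<longleftrightarrow> smooth_on J r \<and> smooth_on J x2 \<and> smooth_on J x4"
  by (auto simp: smooth_on_vec_iff[OF assms] forall_4 profile_curve_def smooth_on_const[OF assms])

text \<open>Unit speed makes the square of the velocity equal to \<open>1\<close>; this is how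
  spacelikeness comes back from the locale.\<close>

lemma generating_curve_iff:
  "generating_curve J r x2 x4 \<longleftrightarrow> open_interval J \<and> unit_profile J r x2 x4"
proof
  assume "generating_curve J r x2 x4"
  then show "open_interval J \<and> unit_profile J r x2 x4"
    using smooth_on_profile_curve_iff[of J r x2 x4]
    by (auto simp: generating_curve_def unit_profile_def open_interval_def spacelike_curve_def)
next
  assume L: "open_interval J \<and> unit_profile J r x2 x4"
  then interpret unit_profile J r x2 x4 by simp
  have "spacelike (vector_derivative (profile_curve r x2 x4) (at u))" if "u \<in> J" for u
    using vector_derivative_at[OF has_vector_derivative_profile_curve[OF that]] unit_speed[OF that]
    by (simp add: spacelike_def ip_def power2_eq_square)
  then show "generating_curve J r x2 x4"
    using L smooth_on_profile_curve_iff[OF open_J] smooth_r smooth_x2 smooth_x4 r_pos unit_speed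
    by (simp add: generating_curve_def spacelike_curve_def)
qed

section \<open>Quasi-minimal profile curves\<close>

lemma deriv_eq_on_open:
  assumes "open S" "u \<in> S" "\<And>x. x \<in> S \<Longrightarrow> f x = g x" "(g has_real_derivative d) (at u)"
  shows "deriv f u = d"
  using has_field_derivative_transform_within_open[OF assms(4,1,2)] assms(3) DERIV_imp_deriv by metis

lemma wronskian_swap: "wronskian g f u = - wronskian f g u"
  by (simp add: wronskian_def)

text \<open>The terms with \<open>s'\<close> cancel, leaving the hyperbolic analogue of squared
  radius times angular velocity. The order of \<open>f\<close> and \<open>g\<close> fixes the sign,
  and combined with \<open>wronskian_swap\<close> it gives \<open>(1 - r'\<^sup>2) \<phi>'\<close>
  in both cases.\<close>

lemma wronskian_sinh_cosh:
  fixes s \<phi> :: "real \<Rightarrow> real"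
  assumes S: "open S" "u \<in> S"
    and f: "\<And>x. x \<in> S \<Longrightarrow> f x = s x * sinh (\<phi> x)" and g: "\<And>x. x \<in> S \<Longrightarrow> g x = s x * cosh (\<phi> x)"
    and s: "(s has_real_derivative s') (at u)" and \<phi>: "(\<phi> has_real_derivative \<phi>') (at u)"
  shows "wronskian f g u = - ((s u)\<^sup>2 * \<phi>')"
proof -
  have "deriv f u = s' * sinh (\<phi> u) + s u * (cosh (\<phi> u) * \<phi>')"
    by (rule deriv_eq_on_open[OF S f]) (auto intro!: derivative_eq_intros s \<phi>)
  moreover have "deriv g u = s' * cosh (\<phi> u) + s u * (sinh (\<phi> u) * \<phi>')"
    by (rule deriv_eq_on_open[OF S g]) (auto intro!: derivative_eq_intros s \<phi>)
  ultimately have "wronskian f g u = - ((s u)\<^sup>2 * \<phi>' * ((cosh (\<phi> u))\<^sup>2 - (sinh (\<phi> u))\<^sup>2))"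
    using f[OF S(2)] g[OF S(2)] by (simp add: wronskian_def algebra_simps power2_eq_square)
  then show ?thesis by (simp add: cosh_square_eq)
qed

lemma nonzero_continuous_on_interval_sign:
  fixes f :: "real \<Rightarrow> real"
  assumes "is_interval I" "continuous_on I f" "\<And>x. x \<in> I \<Longrightarrow> f x \<noteq> 0"
  shows "(\<forall>x\<in>I. f x > 0) \<or> (\<forall>x\<in>I. f x < 0)"
proof (rule ccontr)
  assume "\<not> ?thesis"
  then obtain x y where xy: "x \<in> I" "f x \<le> 0" "y \<in> I" "f y \<ge> 0" by (auto simp: not_less)
  have "is_interval (f ` I)"
    using assms(1,2) connected_continuous_image is_interval_connected_1 by metis
  with xy have "0 \<in> f ` I"
    using mem_is_interval_1_I[of "f ` I" "f x" "f y" 0] by auto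
  with assms(3) show False by auto
qed

lemma smooth_on_imp_continuous_on:
  fixes f :: "real \<Rightarrow> real"
  shows "smooth_on D f \<Longrightarrow> continuous_on D f"
  by (meson DERIV_isCont continuous_at_imp_continuous_on smooth_on_has_real_derivative)

text \<open>Quasi-minimality expressed entirely by conditions on the profile, so that the remaining
  arguments concern functions of one variable.\<close>

locale quasi_minimal_profile = unit_profile +
  assumes interval: "open_interval J"
    and nondeg: "u \<in> J \<Longrightarrow> (deriv r u)\<^sup>2 \<noteq> 1"
    and radial_nonzero: "u \<in> J \<Longrightarrow> radial_coeff r u \<noteq> 0"
    and wronskian_sq: "u \<in> J \<Longrightarrow>
      (r u * wronskian (deriv x2) (deriv x4) u)\<^sup>2 = (radial_coeff r u)\<^sup>2"

lemma generates_quasi_minimal_iff: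
  assumes "\<And>u. u \<in> J \<Longrightarrow> (deriv r u)\<^sup>2 \<noteq> 1"
  shows "generates_quasi_minimal J r x2 x4 \<longleftrightarrow> quasi_minimal_profile J r x2 x4"
  using unit_profile.quasi_minimal_iff[OF _ assms] assms
  unfolding generates_quasi_minimal_def generating_curve_iff quasi_minimal_profile_def
    quasi_minimal_profile_axioms_def
  by blast

section \<open>The two families generate quasi-minimal surfaces\<close>

lemma angle_function_smooth:
  assumes "open I" "smooth_on I r" "\<And>u. u \<in> I \<Longrightarrow> r u > 0" "\<And>u. u \<in> I \<Longrightarrow> (deriv r u)\<^sup>2 \<noteq> 1"
    and "angle_function I \<eta> r \<phi>"
  shows "smooth_on I \<phi>"
proof (rule smooth_on_antiderivative[OF assms(1)])
  show "(\<phi> has_real_derivative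
      \<eta> * ((r u * deriv (deriv r) u + (deriv r u)\<^sup>2 - 1) / (r u * (1 - (deriv r u)\<^sup>2)))) (at u)"
    if "u \<in> I" for u
    using assms(5) that by (simp add: angle_function_def)
  note d = smooth_on_deriv[OF assms(2,1)]
  \<comment> \<open>The prescribed derivative is thus a smooth quotient, and antiderivatives of
    smooth functions are smooth.\<close>
  have nz: "r u * (1 - (deriv r u)\<^sup>2) \<noteq> 0" if "u \<in> I" for u
    using assms(3,4)[OF that] by simp
  show "smooth_on I (\<lambda>u. \<eta> * ((r u * deriv (deriv r) u + (deriv r u)\<^sup>2 - 1)
      / (r u * (1 - (deriv r u)\<^sup>2))))"
    by (rule smooth_on_mult[OF assms(1) smooth_on_const[OF assms(1)]
          smooth_on_divide[OF assms(1) smooth_on_diff[OF assms(1) smooth_on_add[OF assms(1)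
              smooth_on_mult[OF assms(1,2) smooth_on_deriv[OF d assms(1)]]
              smooth_on_power2[OF assms(1) d]] smooth_on_const[OF assms(1)]]
            smooth_on_mult[OF assms(1,2) smooth_on_diff[OF assms(1) smooth_on_const[OF assms(1)]
                smooth_on_power2[OF assms(1) d]]] nz]])
qed

lemma smooth_on_sqrt_compose:
  fixes f :: "real \<Rightarrow> real"
  assumes "open D" "smooth_on D f" "\<And>x. x \<in> D \<Longrightarrow> f x > 0"
  shows "smooth_on D (\<lambda>x. sqrt (f x))"
  by (rule smooth_on_compose[OF smooth_on_sqrt assms(2,1)]) (use assms(3) in auto)

lemma case_A_quasi_minimal:
  assumes "case_A I \<eta> r \<phi> x2 x4"
  shows "generates_quasi_minimal I r x2 x4"
proof -
  have I: "open_interval I" "open I" and r: "smooth_on I r" "\<And>u. u \<in> I \<Longrightarrow> r u > 0"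
    and r': "\<And>u. u \<in> I \<Longrightarrow> (deriv r u)\<^sup>2 > 1" and P: "\<And>u. u \<in> I \<Longrightarrow> radial_coeff r u \<noteq> 0"
    and \<eta>: "\<eta>\<^sup>2 = 1" and \<phi>: "angle_function I \<eta> r \<phi>"
    and x2: "\<And>u. u \<in> I \<Longrightarrow> (x2 has_real_derivative sqrt ((deriv r u)\<^sup>2 - 1) * sinh (\<phi> u)) (at u)"
    and x4: "\<And>u. u \<in> I \<Longrightarrow> (x4 has_real_derivative sqrt ((deriv r u)\<^sup>2 - 1) * cosh (\<phi> u)) (at u)"
    using assms by (auto simp: case_A_def open_interval_def radial_coeff_def)
  have nd: "(deriv r u)\<^sup>2 \<noteq> 1" if "u \<in> I" for u using r'[OF that] by simp
  define s where "s = (\<lambda>u. sqrt ((deriv r u)\<^sup>2 - 1))"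
  have s2: "(s u)\<^sup>2 = (deriv r u)\<^sup>2 - 1" if "u \<in> I" for u using r'[OF that] by (simp add: s_def)
  have sm_s: "smooth_on I s" unfolding s_def
    by (rule smooth_on_sqrt_compose[OF I(2) smooth_on_diff[OF I(2)
            smooth_on_power2[OF I(2) smooth_on_deriv[OF r(1) I(2)]] smooth_on_const[OF I(2)]]])
      (use r' in simp)
  have sm_\<phi>: "smooth_on I \<phi>" by (rule angle_function_smooth[OF I(2) r nd \<phi>])
  have sm: "smooth_on I (\<lambda>u. s u * sinh (\<phi> u))" "smooth_on I (\<lambda>u. s u * cosh (\<phi> u))"
    by (intro smooth_on_mult[OF I(2) sm_s] smooth_on_compose[OF smooth_on_sinh sm_\<phi> I(2)]
        smooth_on_compose[OF smooth_on_cosh sm_\<phi> I(2)]; simp)+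
  note x = x2[folded s_def] x4[folded s_def]
  have d: "deriv x2 u = s u * sinh (\<phi> u)" "deriv x4 u = s u * cosh (\<phi> u)" if "u \<in> I" for u
    using x[OF that] DERIV_imp_deriv by (auto simp: s_def)
  have "quasi_minimal_profile I r x2 x4"
  proof
    show "smooth_on I x2" "smooth_on I x4"
      by (rule smooth_on_antiderivative[OF I(2) _ sm(1)] smooth_on_antiderivative[OF I(2) _ sm(2)],
          use x in \<open>simp add: s_def\<close>)+
    show "(deriv r u)\<^sup>2 + (deriv x2 u)\<^sup>2 - (deriv x4 u)\<^sup>2 = 1" if "u \<in> I" for u
      using s2[OF that] by (simp add: d[OF that] power_mult_distrib cosh_square_eq algebra_simps)
    show "(r u * wronskian (deriv x2) (deriv x4) u)\<^sup>2 = (radial_coeff r u)\<^sup>2" if u: "u \<in> I" for u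
    proof -
      have "(\<phi> has_real_derivative \<eta> * (radial_coeff r u / (r u * (1 - (deriv r u)\<^sup>2)))) (at u)"
        using \<phi> u by (simp add: angle_function_def radial_coeff_def)
      note w = wronskian_sinh_cosh[OF I(2) u d smooth_on_has_real_derivative[OF sm_s u] this]
      \<comment> \<open>Here \<open>s\<^sup>2 = r'\<^sup>2 - 1\<close>, so the minus sign of
        \<open>wronskian_sinh_cosh\<close> produces the factor \<open>1 - r'\<^sup>2\<close> that
        cancels in \<open>\<phi>'\<close>.\<close>
      have "wronskian (deriv x2) (deriv x4) u =
          (1 - (deriv r u)\<^sup>2) * (\<eta> * (radial_coeff r u / (r u * (1 - (deriv r u)\<^sup>2))))"
        by (simp only: w s2[OF u] minus_mult_left minus_diff_eq)
      also have "\<dots> = \<eta> * radial_coeff r u / r u" using nd[OF u] by simp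
      finally have "r u * wronskian (deriv x2) (deriv x4) u = \<eta> * radial_coeff r u"
        using r(2)[OF u] by simp
      then show ?thesis by (simp add: power_mult_distrib \<eta>)
    qed
  qed (use I r P nd in auto)
  then show ?thesis using generates_quasi_minimal_iff nd by blast
qed

lemma case_B_quasi_minimal:
  assumes "case_B I \<eta> r \<phi> x2 x4"
  shows "generates_quasi_minimal I r x2 x4"
proof -
  have I: "open_interval I" "open I" and r: "smooth_on I r" "\<And>u. u \<in> I \<Longrightarrow> r u > 0"
    and r': "\<And>u. u \<in> I \<Longrightarrow> (deriv r u)\<^sup>2 < 1" and P: "\<And>u. u \<in> I \<Longrightarrow> radial_coeff r u \<noteq> 0"
    and \<eta>: "\<eta>\<^sup>2 = 1" and \<phi>: "angle_function I \<eta> r \<phi>"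
    and x2: "\<And>u. u \<in> I \<Longrightarrow> (x2 has_real_derivative sqrt (1 - (deriv r u)\<^sup>2) * cosh (\<phi> u)) (at u)"
    and x4: "\<And>u. u \<in> I \<Longrightarrow> (x4 has_real_derivative sqrt (1 - (deriv r u)\<^sup>2) * sinh (\<phi> u)) (at u)"
    using assms by (auto simp: case_B_def open_interval_def radial_coeff_def)
  have nd: "(deriv r u)\<^sup>2 \<noteq> 1" if "u \<in> I" for u using r'[OF that] by simp
  define s where "s = (\<lambda>u. sqrt (1 - (deriv r u)\<^sup>2))"
  have s2: "(s u)\<^sup>2 = 1 - (deriv r u)\<^sup>2" if "u \<in> I" for u using r'[OF that] by (simp add: s_def)
  have sm_s: "smooth_on I s" unfolding s_def
    by (rule smooth_on_sqrt_compose[OF I(2) smooth_on_diff[OF I(2) smooth_on_const[OF I(2)]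
            smooth_on_power2[OF I(2) smooth_on_deriv[OF r(1) I(2)]]]])
      (use r' in simp)
  have sm_\<phi>: "smooth_on I \<phi>" by (rule angle_function_smooth[OF I(2) r nd \<phi>])
  have sm: "smooth_on I (\<lambda>u. s u * cosh (\<phi> u))" "smooth_on I (\<lambda>u. s u * sinh (\<phi> u))"
    by (intro smooth_on_mult[OF I(2) sm_s] smooth_on_compose[OF smooth_on_sinh sm_\<phi> I(2)]
        smooth_on_compose[OF smooth_on_cosh sm_\<phi> I(2)]; simp)+
  note x = x2[folded s_def] x4[folded s_def]
  have d: "deriv x2 u = s u * cosh (\<phi> u)" "deriv x4 u = s u * sinh (\<phi> u)" if "u \<in> I" for u
    using x[OF that] DERIV_imp_deriv by (auto simp: s_def)
  have "quasi_minimal_profile I r x2 x4"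
  proof
    show "smooth_on I x2" "smooth_on I x4"
      by (rule smooth_on_antiderivative[OF I(2) _ sm(1)] smooth_on_antiderivative[OF I(2) _ sm(2)],
          use x in \<open>simp add: s_def\<close>)+
    show "(deriv r u)\<^sup>2 + (deriv x2 u)\<^sup>2 - (deriv x4 u)\<^sup>2 = 1" if "u \<in> I" for u
      using s2[OF that] by (simp add: d[OF that] power_mult_distrib cosh_square_eq algebra_simps)
    show "(r u * wronskian (deriv x2) (deriv x4) u)\<^sup>2 = (radial_coeff r u)\<^sup>2" if u: "u \<in> I" for u
    proof -
      have "(\<phi> has_real_derivative \<eta> * (radial_coeff r u / (r u * (1 - (deriv r u)\<^sup>2)))) (at u)"
        using \<phi> u by (simp add: angle_function_def radial_coeff_def)
      \<comment> \<open>Now \<open>x4'\<close> carries \<open>sinh\<close>, so the Wronskian is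
        taken in swapped order. Swapping back removes the minus sign, in accordance with
        \<open>s\<^sup>2 = 1 - r'\<^sup>2\<close>.\<close>
      note w = wronskian_sinh_cosh[OF I(2) u d(2,1) smooth_on_has_real_derivative[OF sm_s u] this]
      have "wronskian (deriv x2) (deriv x4) u =
          (1 - (deriv r u)\<^sup>2) * (\<eta> * (radial_coeff r u / (r u * (1 - (deriv r u)\<^sup>2))))"
        by (simp only: wronskian_swap[of "deriv x2" "deriv x4" u] w s2[OF u] minus_minus)
      also have "\<dots> = \<eta> * radial_coeff r u / r u" using nd[OF u] by simp
      finally have "r u * wronskian (deriv x2) (deriv x4) u = \<eta> * radial_coeff r u"
        using r(2)[OF u] by simp
      then show ?thesis by (simp add: power_mult_distrib \<eta>)
    qed
  qed (use I r P nd in auto)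
  then show ?thesis using generates_quasi_minimal_iff nd by blast
qed

section \<open>The converse: sign, angle and orientation of a quasi-minimal profile\<close>

context quasi_minimal_profile
begin

lemmas smooth_deriv_r = smooth_on_deriv[OF smooth_r open_J]
lemmas smooth_deriv_x2 = smooth_on_deriv[OF smooth_x2 open_J]
lemmas smooth_deriv_x4 = smooth_on_deriv[OF smooth_x4 open_J]

lemma continuous_sign:
  assumes "continuous_on J f" "\<And>u. u \<in> J \<Longrightarrow> f u \<noteq> (0::real)"
  shows "(\<forall>u\<in>J. f u > 0) \<or> (\<forall>u\<in>J. f u < 0)"
  using nonzero_continuous_on_interval_sign[OF _ assms] interval by (simp add: open_interval_def)

lemma ex_eta:
  "\<exists>\<eta>\<in>{1, -1}. \<forall>u\<in>J. r u * wronskian (deriv x2) (deriv x4) u = \<eta> * radial_coeff r u"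
proof -
  \<comment> \<open>The candidate for \<open>\<eta>\<close>: its square is \<open>1\<close>, and it
    is continuous because smoothness makes the second derivatives continuous.\<close>
  let ?q = "\<lambda>u. r u * wronskian (deriv x2) (deriv x4) u / radial_coeff r u"
  have sq: "(?q u)\<^sup>2 = 1" if "u \<in> J" for u
    using radial_nonzero[OF that] wronskian_sq[OF that] by (simp add: power_divide)
  note [continuous_intros] = smooth_on_imp_continuous_on[OF smooth_r]
    smooth_on_imp_continuous_on[OF smooth_deriv_r]
    smooth_on_imp_continuous_on[OF smooth_deriv_x2]
    smooth_on_imp_continuous_on[OF smooth_deriv_x4]
    smooth_on_imp_continuous_on[OF smooth_on_deriv[OF smooth_deriv_r open_J]]
    smooth_on_imp_continuous_on[OF smooth_on_deriv[OF smooth_deriv_x2 open_J]]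
    smooth_on_imp_continuous_on[OF smooth_on_deriv[OF smooth_deriv_x4 open_J]]
  have "continuous_on J ?q"
    using radial_nonzero unfolding wronskian_def radial_coeff_def
    by (intro continuous_intros) auto
  then have "(\<forall>u\<in>J. ?q u > 0) \<or> (\<forall>u\<in>J. ?q u < 0)"
    by (rule continuous_sign) (use sq in force)
  moreover have "?q u = 1 \<or> ?q u = -1" if "u \<in> J" for u
    using sq[OF that] by (simp only: power2_eq_1_iff)
  ultimately have "(\<forall>u\<in>J. ?q u = 1) \<or> (\<forall>u\<in>J. ?q u = -1)"
    by (smt (verit))
  then have "\<exists>\<eta>\<in>{1,-1}. \<forall>u\<in>J. ?q u = \<eta>" by blast
  then show ?thesis
    using radial_nonzero by (auto simp: field_simps)
qed

text \<open>In both cases the angle is recovered as \<open>arsinh\<close> of the quotient of one coordinate velocity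
  by \<open>sqrt \<bar>1 - r'\<^sup>2\<bar>\<close>.\<close>

lemma ex_angle:
  fixes f g :: "real \<Rightarrow> real"
  assumes sm: "smooth_on J f" and g: "\<And>u. u \<in> J \<Longrightarrow> g u > 0"
    and k: "smooth_on J k" "\<And>u. u \<in> J \<Longrightarrow> k u > 0"
    and fg: "\<And>u. u \<in> J \<Longrightarrow> (g u)\<^sup>2 = k u + (f u)\<^sup>2"
  obtains \<phi> where "\<And>u. u \<in> J \<Longrightarrow> f u = sqrt (k u) * sinh (\<phi> u)"
    "\<And>u. u \<in> J \<Longrightarrow> g u = sqrt (k u) * cosh (\<phi> u)"
    "\<And>u. u \<in> J \<Longrightarrow> (\<phi> has_real_derivative - wronskian f g u / k u) (at u)"
proof -
  define \<phi> where "\<phi> = (\<lambda>u. arsinh (f u / sqrt (k u)))"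
  have sk: "smooth_on J (\<lambda>u. sqrt (k u))" by (rule smooth_on_sqrt_compose[OF open_J k])
  have 1: "f u = sqrt (k u) * sinh (\<phi> u)" if "u \<in> J" for u
    using k(2)[OF that] by (simp add: \<phi>_def)
  have 2: "g u = sqrt (k u) * cosh (\<phi> u)" if u: "u \<in> J" for u
  \<comment> \<open>The hypothesis \<open>fg\<close> gives the squares; positivity of
    \<open>g\<close> and of \<open>cosh\<close> selects the root.\<close>
  proof (rule power2_eq_imp_eq)
    show "(g u)\<^sup>2 = (sqrt (k u) * cosh (\<phi> u))\<^sup>2"
      using fg[OF u] k(2)[OF u] unfolding 1[OF u]
      by (simp add: power_mult_distrib cosh_square_eq algebra_simps)
  qed (use g[OF u] k(2)[OF u] in auto)
  have 3: "(\<phi> has_real_derivative - wronskian f g u / k u) (at u)" if u: "u \<in> J" for u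
  proof -
    have ku: "k u > 0" using k(2)[OF u] .
    have "smooth_on J (\<lambda>u. f u / sqrt (k u))"
      by (rule smooth_on_divide[OF open_J sm sk]) (use k(2) in force)
    \<comment> \<open>Only the existence of a derivative \<open>d\<close> is taken from the chain
      rule; its value follows by solving \<open>wronskian_sinh_cosh\<close> for
      \<open>d\<close>.\<close>
    from DERIV_chain2[OF arsinh_real_has_field_derivative smooth_on_has_real_derivative[OF this u]]
    obtain d where d: "(\<phi> has_real_derivative d) (at u)" unfolding \<phi>_def by blast
    have "wronskian f g u = - (k u * d)"
      using wronskian_sinh_cosh[OF open_J u 1 2 smooth_on_has_real_derivative[OF sk u] d] ku by simp
    then have "- wronskian f g u / k u = d" using ku by simp
    with d show ?thesis by simp
  qed
  show ?thesis using that 1 2 3 by blast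
qed

text \<open>Unit speed reads \<open>x4'\<^sup>2 = (r'\<^sup>2 - 1) + x2'\<^sup>2\<close>, so
  \<open>x4'\<close> takes the \<open>cosh\<close> and has to be positive.\<close>

lemma ex_case_A:
  assumes r': "\<And>u. u \<in> J \<Longrightarrow> (deriv r u)\<^sup>2 > 1" and x4': "\<And>u. u \<in> J \<Longrightarrow> deriv x4 u > 0"
  shows "\<exists>\<eta> \<phi>. case_A J \<eta> r \<phi> x2 x4"
proof -
  obtain \<eta> where \<eta>: "\<eta> \<in> {1, -1}"
    "\<And>u. u \<in> J \<Longrightarrow> r u * wronskian (deriv x2) (deriv x4) u = \<eta> * radial_coeff r u"
    using ex_eta by blast
  have k: "smooth_on J (\<lambda>u. (deriv r u)\<^sup>2 - 1)"
    by (rule smooth_on_diff[OF open_J smooth_on_power2[OF open_J smooth_deriv_r]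
          smooth_on_const[OF open_J]])
  obtain \<phi> where \<phi>: "\<And>u. u \<in> J \<Longrightarrow> deriv x2 u = sqrt ((deriv r u)\<^sup>2 - 1) * sinh (\<phi> u)"
    "\<And>u. u \<in> J \<Longrightarrow> deriv x4 u = sqrt ((deriv r u)\<^sup>2 - 1) * cosh (\<phi> u)"
    "\<And>u. u \<in> J \<Longrightarrow> (\<phi> has_real_derivative
      - wronskian (deriv x2) (deriv x4) u / ((deriv r u)\<^sup>2 - 1)) (at u)"
  proof (rule ex_angle[OF smooth_deriv_x2 x4' k])
    show "(deriv x4 u)\<^sup>2 = (deriv r u)\<^sup>2 - 1 + (deriv x2 u)\<^sup>2" if "u \<in> J" for u
      using unit_speed[OF that] by simp
  qed (use r' in auto)
  have "- wronskian (deriv x2) (deriv x4) u / ((deriv r u)\<^sup>2 - 1) =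
      \<eta> * (radial_coeff r u / (r u * (1 - (deriv r u)\<^sup>2)))" if "u \<in> J" for u
  proof -
    have "wronskian (deriv x2) (deriv x4) u = \<eta> * radial_coeff r u / r u"
      using \<eta>(2)[OF that] r_pos[OF that] by (simp add: field_simps)
    then show ?thesis
      using r_pos[OF that] r'[OF that] by (simp add: divide_simps) (simp add: algebra_simps)
  qed
  with \<phi>(3) have "angle_function J \<eta> r \<phi>"
    unfolding angle_function_def radial_coeff_def by metis
  then show ?thesis
    using interval smooth_r r_pos r' radial_nonzero \<eta>(1) has_deriv(2,3) \<phi>(1,2)
    unfolding case_A_def radial_coeff_def by (intro exI[of _ \<eta>] exI[of _ \<phi>]) auto
qed

text \<open>The roles are exchanged: \<open>x2'\<^sup>2 = (1 - r'\<^sup>2) + x4'\<^sup>2\<close>.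
  The Wronskian and the denominator both change sign, so \<open>\<phi>'\<close> has the same formula
  as in case A.\<close>

lemma ex_case_B:
  assumes r': "\<And>u. u \<in> J \<Longrightarrow> (deriv r u)\<^sup>2 < 1" and x2': "\<And>u. u \<in> J \<Longrightarrow> deriv x2 u > 0"
  shows "\<exists>\<eta> \<phi>. case_B J \<eta> r \<phi> x2 x4"
proof -
  obtain \<eta> where \<eta>: "\<eta> \<in> {1, -1}"
    "\<And>u. u \<in> J \<Longrightarrow> r u * wronskian (deriv x2) (deriv x4) u = \<eta> * radial_coeff r u"
    using ex_eta by blast
  have k: "smooth_on J (\<lambda>u. 1 - (deriv r u)\<^sup>2)"
    by (rule smooth_on_diff[OF open_J smooth_on_const[OF open_J]
          smooth_on_power2[OF open_J smooth_deriv_r]])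
  obtain \<phi> where \<phi>: "\<And>u. u \<in> J \<Longrightarrow> deriv x4 u = sqrt (1 - (deriv r u)\<^sup>2) * sinh (\<phi> u)"
    "\<And>u. u \<in> J \<Longrightarrow> deriv x2 u = sqrt (1 - (deriv r u)\<^sup>2) * cosh (\<phi> u)"
    "\<And>u. u \<in> J \<Longrightarrow> (\<phi> has_real_derivative
      - wronskian (deriv x4) (deriv x2) u / (1 - (deriv r u)\<^sup>2)) (at u)"
  proof (rule ex_angle[OF smooth_deriv_x4 x2' k])
    show "(deriv x2 u)\<^sup>2 = 1 - (deriv r u)\<^sup>2 + (deriv x4 u)\<^sup>2" if "u \<in> J" for u
      using unit_speed[OF that] by simp
  qed (use r' in auto)
  have "- wronskian (deriv x4) (deriv x2) u / (1 - (deriv r u)\<^sup>2) =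
      \<eta> * (radial_coeff r u / (r u * (1 - (deriv r u)\<^sup>2)))" if "u \<in> J" for u
  proof -
    have "wronskian (deriv x4) (deriv x2) u = - (\<eta> * radial_coeff r u / r u)"
      using \<eta>(2)[OF that] r_pos[OF that] wronskian_swap[of "deriv x4" "deriv x2" u]
      by (simp add: field_simps)
    then show ?thesis by simp
  qed
  with \<phi>(3) have "angle_function J \<eta> r \<phi>"
    unfolding angle_function_def radial_coeff_def by metis
  then show ?thesis
    using interval smooth_r r_pos r' radial_nonzero \<eta>(1) has_deriv(2,3) \<phi>(1,2)
    unfolding case_B_def radial_coeff_def by (intro exI[of _ \<eta>] exI[of _ \<phi>]) auto
qed

lemma deriv_reflect:
  assumes "smooth_on J f" "u \<in> uminus ` J"
  shows "deriv (\<lambda>u. f (- u)) u = - deriv f (- u)"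
proof (rule DERIV_imp_deriv)
  have "- u \<in> J" using assms(2) by auto
  from DERIV_chain2[OF smooth_on_has_real_derivative[OF assms(1) this] DERIV_minus[OF DERIV_ident]]
  show "((\<lambda>u. f (- u)) has_real_derivative - deriv f (- u)) (at u)" by simp
qed

text \<open>First derivatives change sign and second derivatives do not. Hence the speed and
  \<open>radial_coeff\<close> are preserved, while the Wronskian, with one first and one second
  derivative in each term, changes sign and keeps its square.\<close>

lemma reflect:
  "quasi_minimal_profile (uminus ` J) (\<lambda>u. r (- u)) (\<lambda>u. x2 (- u)) (\<lambda>u. x4 (- u))"
proof -
  have op: "open (uminus ` J)" by (rule open_negations[OF open_J])
  have sm: "smooth_on (uminus ` J) (\<lambda>u. f (- u))" if "smooth_on J f" for f :: "real \<Rightarrow> real"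
    by (rule smooth_on_compose[OF that smooth_on_bounded_linear[OF op
            bounded_linear_minus[OF bounded_linear_ident]] op open_J]) auto
  note d1 = deriv_reflect
  have d2: "deriv (deriv (\<lambda>u. f (- u))) u = deriv (deriv f) (- u)"
    if f: "smooth_on J f" "u \<in> uminus ` J" for f :: "real \<Rightarrow> real" and u
  proof (rule deriv_eq_on_open[OF op f(2) d1[OF f(1)]])
    have "- u \<in> J" using f(2) by auto
    from DERIV_minus[OF DERIV_chain2[OF
          smooth_on_has_real_derivative[OF smooth_on_deriv[OF f(1) open_J] this]
        DERIV_minus[OF DERIV_ident]]]
    show "((\<lambda>u. - deriv f (- u)) has_real_derivative deriv (deriv f) (- u)) (at u)" by simp
  qed
  have "is_interval J" "J \<noteq> {}" using interval by (auto simp: open_interval_def)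
  then have int: "open_interval (uminus ` J)" using op by (simp add: open_interval_def)
  have rad: "radial_coeff (\<lambda>u. r (- u)) u = radial_coeff r (- u)" if "u \<in> uminus ` J" for u
    unfolding radial_coeff_def d1[OF smooth_r that] d2[OF smooth_r that] by simp
  have wr: "wronskian (deriv (\<lambda>u. x2 (- u))) (deriv (\<lambda>u. x4 (- u))) u =
      - wronskian (deriv x2) (deriv x4) (- u)" if "u \<in> uminus ` J" for u
    unfolding wronskian_def d1[OF smooth_x2 that] d2[OF smooth_x2 that] d1[OF smooth_x4 that]
      d2[OF smooth_x4 that] by simp
  show ?thesis
    by unfold_locales
      (use op int sm[OF smooth_r] sm[OF smooth_x2] sm[OF smooth_x4] r_pos unit_speed nondeg
        radial_nonzero wronskian_sq in
        \<open>auto simp: d1[OF smooth_r] d1[OF smooth_x2] d1[OF smooth_x4] rad wr\<close>)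
qed

lemma described_by_casesI:
  assumes "\<exists>\<eta> \<phi>. case_A J \<eta> r \<phi> x2 x4 \<or> case_B J \<eta> r \<phi> x2 x4"
  shows "described_by_cases J r x2 x4"
  unfolding described_by_cases_def by (rule bexI[of _ 1]) (use assms in auto)

lemma described_by_cases_reflectI:
  assumes "\<exists>\<eta> \<phi>. case_A (uminus ` J) \<eta> (\<lambda>u. r (- u)) \<phi> (\<lambda>u. x2 (- u)) (\<lambda>u. x4 (- u)) \<or>
    case_B (uminus ` J) \<eta> (\<lambda>u. r (- u)) \<phi> (\<lambda>u. x2 (- u)) (\<lambda>u. x4 (- u))"
  shows "described_by_cases J r x2 x4"
  unfolding described_by_cases_def by (rule bexI[of _ "-1"]) (use assms in auto)

text \<open>Continuity fixes the sign of \<open>r'\<^sup>2 - 1\<close> and of the velocity carrying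
  \<open>cosh\<close>, so one case and one orientation serve all of \<open>J\<close>.\<close>

lemma described: "described_by_cases J r x2 x4"
proof -
  interpret R: quasi_minimal_profile "uminus ` J" "\<lambda>u. r (- u)" "\<lambda>u. x2 (- u)" "\<lambda>u. x4 (- u)"
    by (rule reflect)
  have "continuous_on J (\<lambda>u. (deriv r u)\<^sup>2 - 1)"
    by (intro continuous_intros smooth_on_imp_continuous_on[OF smooth_deriv_r])
  then consider (A) "\<forall>u\<in>J. (deriv r u)\<^sup>2 > 1" | (B) "\<forall>u\<in>J. (deriv r u)\<^sup>2 < 1"
    using continuous_sign[of "\<lambda>u. (deriv r u)\<^sup>2 - 1"] nondeg by fastforce
  then show ?thesis
  proof cases
    case A
    have "deriv x4 u \<noteq> 0" if "u \<in> J" for u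
    proof
      assume "deriv x4 u = 0"
      with unit_speed[OF that] have "(deriv r u)\<^sup>2 + (deriv x2 u)\<^sup>2 = 1" by simp
      with A[rule_format, OF that] zero_le_power2[of "deriv x2 u"] show False by linarith
    qed
    then consider "\<forall>u\<in>J. deriv x4 u > 0" | "\<forall>u\<in>J. deriv x4 u < 0"
      using continuous_sign[OF smooth_on_imp_continuous_on[OF smooth_deriv_x4]] by blast
    then show ?thesis
    proof cases
      case 1
      with A ex_case_A show ?thesis by (blast intro: described_by_casesI)
    next
      case 2
      have "\<exists>\<eta> \<phi>. case_A (uminus ` J) \<eta> (\<lambda>u. r (- u)) \<phi> (\<lambda>u. x2 (- u)) (\<lambda>u. x4 (- u))"
        by (rule R.ex_case_A)
          (use A 2 in \<open>auto simp: deriv_reflect[OF smooth_r] deriv_reflect[OF smooth_x4]\<close>)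
      then show ?thesis by (blast intro: described_by_cases_reflectI)
    qed
  next
    case B
    have "deriv x2 u \<noteq> 0" if "u \<in> J" for u
    proof
      assume "deriv x2 u = 0"
      with unit_speed[OF that] have "(deriv r u)\<^sup>2 - (deriv x4 u)\<^sup>2 = 1" by simp
      with B[rule_format, OF that] zero_le_power2[of "deriv x4 u"] show False by linarith
    qed
    then consider "\<forall>u\<in>J. deriv x2 u > 0" | "\<forall>u\<in>J. deriv x2 u < 0"
      using continuous_sign[OF smooth_on_imp_continuous_on[OF smooth_deriv_x2]] by blast
    then show ?thesis
    proof cases
      case 1
      with B ex_case_B show ?thesis by (blast intro: described_by_casesI)
    next
      case 2
      have "\<exists>\<eta> \<phi>. case_B (uminus ` J) \<eta> (\<lambda>u. r (- u)) \<phi> (\<lambda>u. x2 (- u)) (\<lambda>u. x4 (- u))"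
        by (rule R.ex_case_B)
          (use B 2 in \<open>auto simp: deriv_reflect[OF smooth_r] deriv_reflect[OF smooth_x2]\<close>)
      then show ?thesis by (blast intro: described_by_cases_reflectI)
    qed
  qed
qed

end

theorem theorem3p6:
  shows "(\<forall>(I :: real set) (\<eta> :: real) (r :: real \<Rightarrow> real) (\<phi> :: real \<Rightarrow> real)
             (x2 :: real \<Rightarrow> real) (x4 :: real \<Rightarrow> real).
            case_A I \<eta> r \<phi> x2 x4 \<longrightarrow> generates_quasi_minimal I r x2 x4) \<and>
         (\<forall>(I :: real set) (\<eta> :: real) (r :: real \<Rightarrow> real) (\<phi> :: real \<Rightarrow> real)
             (x2 :: real \<Rightarrow> real) (x4 :: real \<Rightarrow> real).
            case_B I \<eta> r \<phi> x2 x4 \<longrightarrow> generates_quasi_minimal I r x2 x4) \<and>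
         (\<forall>(J :: real set) (r :: real \<Rightarrow> real) (x2 :: real \<Rightarrow> real) (x4 :: real \<Rightarrow> real).
            generates_quasi_minimal J r x2 x4 \<and> (\<forall>u\<in>J. (deriv r u)\<^sup>2 \<noteq> 1) \<longrightarrow>
            (\<forall>u0\<in>J. \<exists>I. open_interval I \<and> u0 \<in> I \<and> I \<subseteq> J \<and>
               described_by_cases I r x2 x4))"
  \<comment> \<open>For every \<open>u0\<close> the witness interval is \<open>J\<close>
    itself.\<close>
  using case_A_quasi_minimal case_B_quasi_minimal generates_quasi_minimal_iff
    quasi_minimal_profile.described quasi_minimal_profile.interval by (metis order_refl)

end
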